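(* Let $\gamma\in(0,1)$, $\theta>0$, let $\alpha$ be a finite non-atomic measure on $\mathbb{X}$ with $\alpha(\mathbb{X})>0$, let $P_0=\alpha/\alpha(\mathbb{X})$, and let $\tilde P_{\gamma,\theta}$ be the two-parameter Poisson–Dirichlet process with parameters $(\gamma,\theta)$ and base measure $P_0$. Let $g:\mathbb{X}\to\mathbb{R}$ be measurable with $\int_{\mathbb{X}}(1+t|g(x)|)^\gamma\alpha(dx)<\infty$ for any $t>0$. Then the cumulative distribution function $\mathbb{F}(\sigma;g)=\mathbb{P}[\tilde P_{\gamma,\theta}(g)\le\sigma]$ of the mean $\tilde P_{\gamma,\theta}(g)=\int g\,d\tilde P_{\gamma,\theta}$ can be represented as $$\mathbb{F}(\sigma;g)=\frac12-\frac1\pi\int_0^\infty\frac{\sin\Big(\frac{\theta}{\gamma}\arctan\frac{B_\sigma(t)}{A_\sigma(t)}\Big)}{t\,[A_\sigma^2(t)+B_\sigma^2(t)]^{\theta/(2\gamma)}}\,dt,$$ where $$A_\sigma(t)=\int_{\mathbb{X}}[1+t^2(g(x)-\sigma)^2]^{\gamma/2}\cos\{\gamma\arctan[t(g(x)-\sigma)]\}\,P_0(dx),$$ $$B_\sigma(t)=\int_{\mathbb{X}}[1+t^2(g(x)-\sigma)^2]^{\gamma/2}\sin\{\gamma\arctan[t(g(x)-\sigma)]\}\,P_0(dx).$$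
   Context: $\mathbb{X}$ is a Polish space with its Borel $\sigma$-field. Let $\tilde\mu_\gamma$ be the $\gamma$-stable completely random measure on $\mathbb{X}$, i.e. the random measure with independent values on disjoint measurable sets and Laplace functional $\mathbb{E}[e^{-\int f\,d\tilde\mu_\gamma}]=\exp\{-\int_{\mathbb{X}}\int_0^\infty(1-e^{-vf(x)})\frac{\gamma}{\Gamma(1-\gamma)}v^{-1-\gamma}\,dv\,\alpha(dx)\}$ for $f\ge0$ with finite exponent, and let $\mathcal{Q}_\gamma$ be its law on the space of boundedly finite measures on $\mathbb{X}$. Let $\mathcal{Q}_{\gamma,\theta}$ be the probability law absolutely continuous with respect to $\mathcal{Q}_\gamma$ with Radon–Nikodym derivative proportional to $\mu\mapsto(\mu(\mathbb{X}))^{-\theta}$, and let $\tilde\mu_{\gamma,\theta}$ be a random measure with law $\mathcal{Q}_{\gamma,\theta}$. The two-parameter Poisson–Dirichlet process is $\tilde P_{\gamma,\theta}=\tilde\mu_{\gamma,\theta}/\tilde\mu_{\gamma,\theta}(\mathbb{X})$.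
   Formalization: The formal theorem additionally assumes that g is not α-almost everywhere equal to σ; in that excluded case the printed formula fails, since 𝔽(σ;g)=1 while B_σ=0 makes the right-hand side 1/2. *)

theory Defs
  imports "HOL-Probability.Probability"
begin

text \<open>
  The space of boundedly finite Borel measures on a Polish space. Boundedness refers to the
  complete metric that the class \<^class>\<open>polish_space\<close> carries, and the \<open>\<sigma>\<close>-field is the one
  generated by the evaluations \<open>\<mu> \<mapsto> \<mu>(A)\<close>, as in \<^const>\<open>subprob_algebra\<close>.
\<close>

definition boundedly_finite :: "'a::polish_space measure \<Rightarrow> bool" where
  "boundedly_finite \<mu> \<longleftrightarrow>
     sets \<mu> = sets borel \<and> (\<forall>A\<in>sets borel. bounded A \<longrightarrow> emeasure \<mu> A < \<infinity>)"

definition bfm_algebra :: "'a::polish_space measure measure" where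
  "bfm_algebra =
     (SUP A \<in> sets borel. vimage_algebra {\<mu>. boundedly_finite \<mu>} (\<lambda>\<mu>. emeasure \<mu> A) borel)"

definition non_atomic :: "'a measure \<Rightarrow> bool" where
  "non_atomic \<mu> \<longleftrightarrow>
     \<not> (\<exists>A\<in>sets \<mu>. emeasure \<mu> A > 0 \<and>
          (\<forall>B\<in>sets \<mu>. B \<subseteq> A \<longrightarrow> emeasure \<mu> B = 0 \<or> emeasure \<mu> (A - B) = 0))"

text \<open>The map \<open>x \<mapsto> exp(-x)\<close> on \<open>[0,\<infinity>]\<close>, with \<open>exp(-\<infinity>) = 0\<close>.\<close>

definition exp_neg :: "ennreal \<Rightarrow> real" where
  "exp_neg x = (if x = \<infinity> then 0 else exp (- enn2real x))"

definition stable_exponent :: "real \<Rightarrow> 'a measure \<Rightarrow> ('a \<Rightarrow> real) \<Rightarrow> ennreal" where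
  "stable_exponent \<gamma> \<alpha> f =
     (\<integral>\<^sup>+x. (\<integral>\<^sup>+v\<in>{0<..}. ennreal ((1 - exp (- (v * f x))) *
         (\<gamma> / Gamma (1 - \<gamma>) * v powr (- 1 - \<gamma>))) \<partial>lborel) \<partial>\<alpha>)"

definition stable_CRM ::
  "'s measure \<Rightarrow> real \<Rightarrow> 'a::polish_space measure \<Rightarrow> ('s \<Rightarrow> 'a measure) \<Rightarrow> bool" where
  "stable_CRM S \<gamma> \<alpha> \<mu> \<longleftrightarrow>
     prob_space S \<and>
     \<mu> \<in> measurable S bfm_algebra \<and>
     (\<forall>(n::nat) A. (\<forall>i<n. A i \<in> sets borel) \<longrightarrow> disjoint_family_on A {..<n} \<longrightarrow>
        prob_space.indep_vars S (\<lambda>_. borel) (\<lambda>i s. emeasure (\<mu> s) (A i)) {..<n}) \<and>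
     (\<forall>f\<in>borel_measurable borel. (\<forall>x. 0 \<le> f x) \<longrightarrow> stable_exponent \<gamma> \<alpha> f < \<infinity> \<longrightarrow>
        (\<integral>s. exp_neg (\<integral>\<^sup>+x. ennreal (f x) \<partial>\<mu> s) \<partial>S) = exp_neg (stable_exponent \<gamma> \<alpha> f))"

text \<open>
  The weight \<open>\<mu>(X) powr (-\<theta>)\<close> for \<open>\<theta> > 0\<close> with values in \<open>[0,\<infinity>]\<close>: it is \<open>\<infinity>\<close> if \<open>\<mu>(X) = 0\<close> and
  \<open>0\<close> if \<open>\<mu>(X) = \<infinity>\<close>.
\<close>

definition mass_weight :: "real \<Rightarrow> 'a measure \<Rightarrow> ennreal" where
  "mass_weight \<theta> \<mu> =
     (if emeasure \<mu> (space \<mu>) = \<infinity> then 0 else inverse (ennreal (measure \<mu> (space \<mu>) powr \<theta>)))"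

definition tilted_law :: "real \<Rightarrow> 'a measure measure \<Rightarrow> 'a measure measure" where
  "tilted_law \<theta> Q = density Q (\<lambda>\<mu>. mass_weight \<theta> \<mu> / (\<integral>\<^sup>+\<nu>. mass_weight \<theta> \<nu> \<partial>Q))"

definition normalized :: "'a measure \<Rightarrow> 'a measure" where
  "normalized \<mu> = scale_measure (1 / emeasure \<mu> (space \<mu>)) \<mu>"

definition A_fun :: "real \<Rightarrow> 'a measure \<Rightarrow> ('a \<Rightarrow> real) \<Rightarrow> real \<Rightarrow> real \<Rightarrow> real" where
  "A_fun \<gamma> P0 g \<sigma> t =
     (\<integral>x. (1 + t\<^sup>2 * (g x - \<sigma>)\<^sup>2) powr (\<gamma> / 2) * cos (\<gamma> * arctan (t * (g x - \<sigma>))) \<partial>P0)"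

definition B_fun :: "real \<Rightarrow> 'a measure \<Rightarrow> ('a \<Rightarrow> real) \<Rightarrow> real \<Rightarrow> real \<Rightarrow> real" where
  "B_fun \<gamma> P0 g \<sigma> t =
     (\<integral>x. (1 + t\<^sup>2 * (g x - \<sigma>)\<^sup>2) powr (\<gamma> / 2) * sin (\<gamma> * arctan (t * (g x - \<sigma>))) \<partial>P0)"

definition cdf_integrand ::
  "real \<Rightarrow> real \<Rightarrow> 'a measure \<Rightarrow> ('a \<Rightarrow> real) \<Rightarrow> real \<Rightarrow> real \<Rightarrow> real" where
  "cdf_integrand \<gamma> \<theta> P0 g \<sigma> t =
     sin (\<theta> / \<gamma> * arctan (B_fun \<gamma> P0 g \<sigma> t / A_fun \<gamma> P0 g \<sigma> t)) /
     (t * ((A_fun \<gamma> P0 g \<sigma> t)\<^sup>2 + (B_fun \<gamma> P0 g \<sigma> t)\<^sup>2) powr (\<theta> / (2 * \<gamma>)))"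

end

theory Submission
  imports Defs "HOL-Complex_Analysis.Complex_Analysis" "HOL-Real_Asymp.Real_Asymp"
begin

text \<open>
  Write \<open>h = g - \<sigma>\<close>, and for the stable random measure \<open>\<mu>\<close> let \<open>X = \<integral> h d\<mu>\<close> and let \<open>M\<close> be its total mass.
  The event in question is \<open>X \<le> 0\<close>, and it does not change if \<open>X\<close> is multiplied by a positive random
  factor. Since \<open>\<Gamma>(\<theta>) M powr (-\<theta>) = \<integral> u powr (\<theta> - 1) exp (- u M) du\<close>, the tilted law is the marginal of
  the law of a pair \<open>(\<mu>, u)\<close> with density proportional to \<open>u powr (\<theta> - 1) exp (- u M)\<close> with respect to
  \<open>\<Q>\<^sub>\<gamma>(d\<mu>) du\<close>. Under this law \<open>Z = u X\<close> has an explicit characteristic function: by the Laplace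
  functional, continued analytically to complex arguments, it is proportional to
  \<open>\<integral> u powr (\<theta> - 1) exp (- K(t) u powr \<gamma>) du\<close>, hence to \<open>K(t) powr (-\<theta> / \<gamma>)\<close>, where
  \<open>K(t) = \<integral> (1 - \<i> t h) powr \<gamma> d\<alpha>\<close> is a multiple of \<open>A\<^sub>\<sigma>(t) - \<i> B\<^sub>\<sigma>(t)\<close>. The formula is the Gil-Pelaez
  inversion of this characteristic function at \<open>0\<close>; it decays like \<open>t powr (-\<theta>)\<close>, so \<open>Z\<close> has no atom there.
\<close>

section \<open>Differentiation under the integral sign\<close>

text \<open>The obstacle is that the Laplace functional speaks only of nonnegative functions, while
  \<open>h\<close> has both signs and \<open>X\<close> in general has no exponential moments: for
  real \<open>c\<close> other than 0 the function \<open>u + c * h\<close> may take negative values,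
  so no open set of arguments is available to continue from. An auxiliary damping by
  \<open>\<epsilon>\<close> times the integral of \<open>\<bar>h\<bar>\<close> opens a strip; it is
  removed afterwards, on the imaginary axis. A second continuation, in the rate \<open>K\<close>,
  replaces the rotation of a contour. No moment of the stable law is computed directly. Finiteness
  of the moment of \<open>M\<close> of order \<open>-\<theta>\<close>, and of the stretched
  exponential integral, is read off from the tilted law having mass one; the normalising factor is
  read off from the value 1 of the characteristic function at 0. Only the power
  \<open>\<bar>h\<bar> powr \<gamma>\<close> is integrable, so all bounds are in terms of
  \<open>\<bar>t * h\<bar> powr \<gamma>\<close>: the growth of the real part of \<open>K(t)\<close>
  at this rate controls large \<open>t\<close>, the size of its imaginary part controls
  \<open>t\<close> near 0.\<close>

lemma has_field_derivative_integral:
  fixes F F' :: "'a \<Rightarrow> complex \<Rightarrow> complex"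
  assumes U: "open U" "convex U" "z \<in> U"
    and int: "\<And>y. y \<in> U \<Longrightarrow> integrable M (\<lambda>x. F x y)"
    and deriv: "\<And>x y. x \<in> space M \<Longrightarrow> y \<in> U \<Longrightarrow> (F x has_field_derivative F' x y) (at y)"
    and w: "integrable M w" "\<And>x y. x \<in> space M \<Longrightarrow> y \<in> U \<Longrightarrow> norm (F' x y) \<le> w x"
    and meas: "(\<lambda>x. F' x z) \<in> borel_measurable M"
  shows "((\<lambda>y. \<integral>x. F x y \<partial>M) has_field_derivative (\<integral>x. F' x z \<partial>M)) (at z)"
proof -
  have "((\<lambda>y. ((\<integral>x. F x y \<partial>M) - (\<integral>x. F x z \<partial>M)) / (y - z)) \<longlongrightarrow> (\<integral>x. F' x z \<partial>M)) (at z within U)"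
    unfolding tendsto_at_iff_sequentially comp_def
  proof (intro allI impI)
    fix X assume X: "\<forall>i. X i \<in> U - {z}" "X \<longlonglongrightarrow> z"
    have "(\<lambda>i. \<integral>x. (F x (X i) - F x z) / (X i - z) \<partial>M) \<longlonglongrightarrow> (\<integral>x. F' x z \<partial>M)"
    proof (rule integral_dominated_convergence[where w = w])
      show "AE x in M. (\<lambda>i. (F x (X i) - F x z) / (X i - z)) \<longlonglongrightarrow> F' x z"
      proof (rule AE_I2)
        fix x assume x: "x \<in> space M"
        have "((\<lambda>y. (F x y - F x z) / (y - z)) \<longlongrightarrow> F' x z) (at z within U)"
          using has_field_derivative_at_within[OF deriv[OF x U(3)]]
          by (simp add: has_field_derivative_iff)
        then show "(\<lambda>i. (F x (X i) - F x z) / (X i - z)) \<longlonglongrightarrow> F' x z"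
          using X unfolding tendsto_at_iff_sequentially comp_def by blast
      qed
      show "AE x in M. norm ((F x (X i) - F x z) / (X i - z)) \<le> w x" for i
      proof (rule AE_I2)
        fix x assume x: "x \<in> space M"
        \<comment> \<open>Mean value inequality on the convex set \<open>U\<close>: the bound on the
          derivative dominates all difference quotients at once.\<close>
        have "norm (F x (X i) - F x z) \<le> w x * norm (X i - z)"
          using X(1) U x w(2)
          by (intro field_differentiable_bound[of U "F x" "F' x"]) (auto intro: has_field_derivative_at_within deriv)
        then show "norm ((F x (X i) - F x z) / (X i - z)) \<le> w x"
          using X(1)[rule_format, of i] by (simp add: norm_divide divide_le_eq)
      qed
      show "(\<lambda>x. (F x (X i) - F x z) / (X i - z)) \<in> borel_measurable M" for i
        using int[of "X i"] int[OF U(3)] X(1) by (auto intro!: borel_measurable_divide borel_measurable_diff)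
    qed (use meas w in auto)
    moreover have "(\<integral>x. (F x (X i) - F x z) / (X i - z) \<partial>M)
        = ((\<integral>x. F x (X i) \<partial>M) - (\<integral>x. F x z \<partial>M)) / (X i - z)" for i
      using int[of "X i"] int[OF U(3)] X(1) by (subst integral_divide_zero) (simp add: Bochner_Integration.integral_diff)
    ultimately show "(\<lambda>i. ((\<integral>x. F x (X i) \<partial>M) - (\<integral>x. F x z \<partial>M)) / (X i - z)) \<longlonglongrightarrow> (\<integral>x. F' x z \<partial>M)"
      by (simp only:)
  qed
  then have "((\<lambda>y. \<integral>x. F x y \<partial>M) has_field_derivative (\<integral>x. F' x z \<partial>M)) (at z within U)"
    by (simp add: has_field_derivative_iff)
  then show ?thesis
    using U at_within_open by metis
qed

text \<open>Majorant for the derivative of \<open>exp (- (c * y))\<close> in \<open>c\<close>,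
  uniform near \<open>c0\<close>. One factor \<open>exp (\<eta> * \<bar>y\<bar>)\<close> absorbs
  \<open>\<bar>y\<bar>\<close>, a second one pays for moving \<open>c\<close> to \<open>c0\<close>;
  the two summands serve the two signs of \<open>y\<close>.\<close>

lemma abs_mult_exp_le:
  fixes c0 c \<eta> y :: real
  assumes "0 < \<eta>" "\<bar>c - c0\<bar> \<le> \<eta>"
  shows "\<bar>y\<bar> * exp (- (c * y)) \<le> (exp (- ((c0 - 2*\<eta>) * y)) + exp (- ((c0 + 2*\<eta>) * y))) / \<eta>"
proof -
  have "\<eta> * \<bar>y\<bar> \<le> exp (\<eta> * \<bar>y\<bar>)"
    using exp_ge_add_one_self[of "\<eta> * \<bar>y\<bar>"] by linarith
  then have "\<eta> * (\<bar>y\<bar> * exp (- (c * y))) \<le> exp (\<eta> * \<bar>y\<bar>) * exp (- (c * y))"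
    by (simp add: mult.assoc[symmetric] mult_right_mono)
  also have "\<dots> = exp (\<eta> * \<bar>y\<bar> - c * y)" by (simp add: exp_diff exp_minus field_simps)
  also have "\<eta> * \<bar>y\<bar> - c * y \<le> 2 * \<eta> * \<bar>y\<bar> - c0 * y"
  proof -
    have "(c0 - c) * y \<le> \<bar>c - c0\<bar> * \<bar>y\<bar>"
      by (metis abs_ge_self abs_minus_commute abs_mult)
    also have "\<dots> \<le> \<eta> * \<bar>y\<bar>" using assms by (intro mult_right_mono) auto
    finally show ?thesis by (simp add: algebra_simps)
  qed
  then have "exp (\<eta> * \<bar>y\<bar> - c * y) \<le> exp (2 * \<eta> * \<bar>y\<bar> - c0 * y)" by simp
  also have "\<dots> \<le> exp (- ((c0 - 2*\<eta>) * y)) + exp (- ((c0 + 2*\<eta>) * y))"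
    by (cases "y \<ge> 0") (auto simp: algebra_simps intro: add_increasing add_increasing2)
  finally show ?thesis using assms by (simp add: field_simps)
qed

text \<open>The modulus of the integrand depends only on \<open>Re z\<close>, so integrability for
  real parameters suffices. Since \<open>S\<close> is open, the parameter can be moved a little to
  both sides, which makes the derivative integrable as well.\<close>

lemma holomorphic_on_laplace:
  fixes w \<xi> :: "'a \<Rightarrow> real"
  assumes [measurable]: "\<xi> \<in> borel_measurable M" "w \<in> borel_measurable M"
    and w0: "\<And>x. 0 \<le> w x"
    and S: "open S"
    and int: "\<And>c. c \<in> S \<Longrightarrow> integrable M (\<lambda>x. w x * exp (- (c * \<xi> x)))"
  shows "(\<lambda>z. \<integral>x. of_real (w x) * exp (- (z * of_real (\<xi> x))) \<partial>M) holomorphic_on {z. Re z \<in> S}"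
proof -
  have op: "open {z. Re z \<in> S}"
    using open_vimage[OF S continuous_on_Re[OF continuous_on_id]] by (simp add: vimage_def)
  have intc: "integrable M (\<lambda>x. complex_of_real (w x) * exp (- (z * of_real (\<xi> x))))" if "Re z \<in> S" for z
    by (rule Bochner_Integration.integrable_bound[OF int[OF that]]) (auto simp: norm_mult w0)
  have "\<exists>D. ((\<lambda>z. \<integral>x. complex_of_real (w x) * exp (- (z * of_real (\<xi> x))) \<partial>M) has_field_derivative D) (at z)"
    if z: "Re z \<in> S" for z
  proof -
    obtain e where e: "e > 0" "\<And>c. \<bar>c - Re z\<bar> < e \<Longrightarrow> c \<in> S"
      using S z unfolding open_dist dist_real_def by metis
    \<comment> \<open>A third of the radius, because the majorant uses the parameters
      \<open>Re z - 2 * \<eta>\<close> and \<open>Re z + 2 * \<eta>\<close>, which must still lie in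
      \<open>S\<close>.\<close>
    define \<eta> where "\<eta> = e / 3"
    have \<eta>: "\<eta> > 0" "3 * \<eta> = e" using e by (auto simp: \<eta>_def)
    let ?c = "Re z"
    have sub: "Re y \<in> S \<and> \<bar>Re y - Re z\<bar> \<le> \<eta>" if "y \<in> ball z \<eta>" for y
    proof -
      have "\<bar>Re y - Re z\<bar> \<le> dist y z"
        using abs_Re_le_cmod[of "y - z"] by (simp add: dist_norm)
      then show ?thesis using that e \<eta> by (auto simp: dist_commute)
    qed
    have "((\<lambda>z. \<integral>x. complex_of_real (w x) * exp (- (z * of_real (\<xi> x))) \<partial>M) has_field_derivative 
       (\<integral>x. complex_of_real (w x) * (- of_real (\<xi> x) * exp (- (z * of_real (\<xi> x)))) \<partial>M)) (at z)"
    proof (rule has_field_derivative_integral[where U = "ball z \<eta>" and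
        w = "\<lambda>x. (w x * exp (- ((?c - 2*\<eta>) * \<xi> x)) + w x * exp (- ((?c + 2*\<eta>) * \<xi> x))) / \<eta>"])
      show "integrable M (\<lambda>x. (w x * exp (- ((?c - 2*\<eta>) * \<xi> x)) + w x * exp (- ((?c + 2*\<eta>) * \<xi> x))) / \<eta>)"
        using \<eta> by (intro integrable_divide Bochner_Integration.integrable_add int e(2)) auto
      show "norm (complex_of_real (w x) * (- of_real (\<xi> x) * exp (- (y * of_real (\<xi> x)))))
         \<le> (w x * exp (- ((?c - 2*\<eta>) * \<xi> x)) + w x * exp (- ((?c + 2*\<eta>) * \<xi> x))) / \<eta>"
        if "y \<in> ball z \<eta>" for x y
        using mult_left_mono[OF abs_mult_exp_le[OF \<eta>(1) conjunct2[OF sub[OF that]], of "\<xi> x"] w0[of x]] w0[of x]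
        by (simp add: norm_mult distrib_left)
    qed (use \<eta> sub intc in \<open>auto intro!: derivative_eq_intros\<close>)
    then show ?thesis by blast
  qed
  then show ?thesis
    unfolding holomorphic_on_open[OF op] by simp
qed

section \<open>The stable Levy measure\<close>

text \<open>Euler's integral after rescaling. It serves twice: with \<open>p = 1 - \<gamma>\<close>
  it evaluates the Levy integral, with \<open>p = \<theta>\<close> it turns a negative power of the
  total mass into a mixture of exponentials.\<close>

lemma nn_integral_powr_exp:
  fixes p m :: real
  assumes p: "0 < p" and m: "0 < m"
  shows "(\<integral>\<^sup>+u\<in>{0<..}. ennreal (u powr (p - 1) * exp (- (u * m))) \<partial>lborel) = ennreal (Gamma p * m powr (- p))"
proof -
  have "ennreal (Gamma p) = (\<integral>\<^sup>+u. ennreal (indicator {0..} u * u powr (p - 1) / exp u) \<partial>lborel)"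
    using Gamma_conv_nn_integral_real[OF p] by simp
  also have "\<dots> = ennreal m * (\<integral>\<^sup>+u. ennreal (indicator {0..} (m * u) * (m * u) powr (p - 1) / exp (m * u)) \<partial>lborel)"
    using m by (subst nn_integral_real_affine[where c = m and t = 0]) auto
  also have "(\<integral>\<^sup>+u. ennreal (indicator {0..} (m * u) * (m * u) powr (p - 1) / exp (m * u)) \<partial>lborel)
      = (\<integral>\<^sup>+u. ennreal (m powr (p - 1)) * (ennreal (u powr (p - 1) * exp (- (u * m))) * indicator {0<..} u) \<partial>lborel)"
  proof (intro nn_integral_cong_AE AE_I2)
    fix u :: real
    show "ennreal (indicator {0..} (m * u) * (m * u) powr (p - 1) / exp (m * u))
       = ennreal (m powr (p - 1)) * (ennreal (u powr (p - 1) * exp (- (u * m))) * indicator {0<..} u)"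
      using m by (cases "u > 0") (auto simp: indicator_def zero_le_mult_iff powr_mult exp_minus field_simps ennreal_mult'' [symmetric])
  qed
  also have "\<dots> = ennreal (m powr (p - 1)) * (\<integral>\<^sup>+u. ennreal (u powr (p - 1) * exp (- (u * m))) * indicator {0<..} u \<partial>lborel)"
    by (rule nn_integral_cmult) auto
  also have "ennreal m * (ennreal (m powr (p - 1)) * (\<integral>\<^sup>+u. ennreal (u powr (p - 1) * exp (- (u * m))) * indicator {0<..} u \<partial>lborel))
      = ennreal (m powr p) * (\<integral>\<^sup>+u. ennreal (u powr (p - 1) * exp (- (u * m))) * indicator {0<..} u \<partial>lborel)"
    using m by (simp add: mult.assoc[symmetric] ennreal_mult''[symmetric] powr_diff)
  finally have "ennreal (m powr (- p)) * ennreal (Gamma p) = ennreal (m powr (- p)) * (ennreal (m powr p) * (\<integral>\<^sup>+u. ennreal (u powr (p - 1) * exp (- (u * m))) * indicator {0<..} u \<partial>lborel))"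
    by simp
  also have "\<dots> = (\<integral>\<^sup>+u. ennreal (u powr (p - 1) * exp (- (u * m))) * indicator {0<..} u \<partial>lborel)"
    using m by (simp add: mult.assoc[symmetric] ennreal_mult''[symmetric] powr_add[symmetric])
  finally show ?thesis
    by (simp add: ennreal_mult''[symmetric] mult.commute)
qed

lemma nn_integral_powr_0:
  fixes \<gamma> f :: real
  assumes "0 < \<gamma>" "0 \<le> f"
  shows "(\<integral>\<^sup>+u\<in>{0<..f}. ennreal (\<gamma> * u powr (\<gamma> - 1)) \<partial>lborel) = ennreal (f powr \<gamma>)"
proof -
  have "((\<lambda>u. \<gamma> * u powr (\<gamma> - 1)) has_integral (\<gamma> * (f powr (\<gamma> - 1 + 1) / (\<gamma> - 1 + 1)))) {0..f}"
    using assms by (intro has_integral_mult_right has_integral_powr_from_0) auto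
  then have "(\<integral>\<^sup>+u\<in>{0..f}. ennreal (\<gamma> * u powr (\<gamma> - 1)) \<partial>lborel) = ennreal (f powr \<gamma>)"
    using assms by (subst nn_integral_has_integral_lebesgue') auto
  moreover have "(\<integral>\<^sup>+u\<in>{0..f}. ennreal (\<gamma> * u powr (\<gamma> - 1)) \<partial>lborel) = (\<integral>\<^sup>+u\<in>{0<..f}. ennreal (\<gamma> * u powr (\<gamma> - 1)) \<partial>lborel)"
    using AE_lborel_singleton[of 0] by (intro nn_integral_cong_AE) (auto simp: indicator_def)
  ultimately show ?thesis by simp
qed

text \<open>Write \<open>1 - exp (- (v * f))\<close> as the integral of
  \<open>v * exp (- (u * v))\<close> over \<open>u\<close> from 0 to \<open>f\<close> and exchange
  the integrals. The inner integral becomes a Gamma integral in \<open>v\<close>, and the factor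
  \<open>\<gamma> / Gamma (1 - \<gamma>)\<close> is the one that leaves exactly
  \<open>f powr \<gamma>\<close>.\<close>

lemma stable_Levy_integral:
  fixes \<gamma> f :: real
  assumes \<gamma>: "0 < \<gamma>" "\<gamma> < 1" and f: "0 \<le> f"
  shows "(\<integral>\<^sup>+v\<in>{0<..}. ennreal ((1 - exp (- (v * f))) * (\<gamma> / Gamma (1 - \<gamma>) * v powr (- 1 - \<gamma>))) \<partial>lborel)
    = ennreal (f powr \<gamma>)"
proof -
  define c where "c = \<gamma> / Gamma (1 - \<gamma>)"
  have G: "Gamma (1 - \<gamma>) > 0" using \<gamma> by (intro Gamma_real_pos) auto
  have c: "c > 0" using \<gamma> G by (simp add: c_def)
  have inner: "ennreal (1 - exp (- (v * f))) = (\<integral>\<^sup>+u\<in>{0..f}. ennreal (v * exp (- (u * v))) \<partial>lborel)" if v: "v > 0" for v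
  proof -
    have "(\<integral>\<^sup>+u. ennreal (v * exp (- (u * v))) * indicator {0..f} u \<partial>lborel) = - exp (- (f * v)) - (- exp (- (0 * v)))"
      using v f by (intro nn_integral_FTC_Icc[where F = "\<lambda>u. - exp (- (u * v))"])
         (auto intro!: derivative_eq_intros simp: has_real_derivative_iff_has_vector_derivative[symmetric])
    then show ?thesis by (simp add: mult.commute)
  qed
  have "(\<integral>\<^sup>+v\<in>{0<..}. ennreal ((1 - exp (- (v * f))) * (c * v powr (- 1 - \<gamma>))) \<partial>lborel)
      = (\<integral>\<^sup>+v. (\<integral>\<^sup>+u. ennreal (c * v powr (- 1 - \<gamma>) * (v * exp (- (u * v)))) * indicator {0<..} v * indicator {0..f} u \<partial>lborel) \<partial>lborel)"
  proof (rule nn_integral_cong)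
    fix v :: real
    show "ennreal ((1 - exp (- (v * f))) * (c * v powr (- 1 - \<gamma>))) * indicator {0<..} v
      = (\<integral>\<^sup>+u. ennreal (c * v powr (- 1 - \<gamma>) * (v * exp (- (u * v)))) * indicator {0<..} v * indicator {0..f} u \<partial>lborel)"
    proof (cases "v > 0")
      case True
      have "ennreal ((1 - exp (- (v * f))) * (c * v powr (- 1 - \<gamma>))) = ennreal (c * v powr (- 1 - \<gamma>)) * ennreal (1 - exp (- (v * f)))"
        using c by (subst ennreal_mult'[symmetric]) (auto simp: mult.commute)
      also have "\<dots> = (\<integral>\<^sup>+u. ennreal (c * v powr (- 1 - \<gamma>)) * (ennreal (v * exp (- (u * v))) * indicator {0..f} u) \<partial>lborel)"
        unfolding inner[OF True] by (rule nn_integral_cmult[symmetric]) auto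
      also have "\<dots> = (\<integral>\<^sup>+u. ennreal (c * v powr (- 1 - \<gamma>) * (v * exp (- (u * v)))) * indicator {0<..} v * indicator {0..f} u \<partial>lborel)"
        using True c by (intro nn_integral_cong) (auto simp: mult.assoc[symmetric] ennreal_mult')
      finally show ?thesis using True by simp
    qed auto
  qed
  also have "\<dots> = (\<integral>\<^sup>+u. (\<integral>\<^sup>+v. ennreal (c * v powr (- 1 - \<gamma>) * (v * exp (- (u * v)))) * indicator {0<..} v * indicator {0..f} u \<partial>lborel) \<partial>lborel)"
    by (rule lborel_pair.Fubini') measurable
  also have "\<dots> = (\<integral>\<^sup>+u. ennreal (\<gamma> * u powr (\<gamma> - 1)) * indicator {0<..f} u \<partial>lborel)"
  proof (intro nn_integral_cong_AE)
    \<comment> \<open>The point \<open>u = 0\<close> has to be discarded: the integral over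
      \<open>v\<close> diverges there.\<close>
    show "AE u in lborel. (\<integral>\<^sup>+v. ennreal (c * v powr (- 1 - \<gamma>) * (v * exp (- (u * v)))) * indicator {0<..} v * indicator {0..f} u \<partial>lborel)
       = ennreal (\<gamma> * u powr (\<gamma> - 1)) * indicator {0<..f} u"
      using AE_lborel_singleton[of 0]
    proof eventually_elim
      case (elim u)
      show ?case
      proof (cases "u \<in> {0<..f}")
        case True
        have "(\<integral>\<^sup>+v. ennreal (c * v powr (- 1 - \<gamma>) * (v * exp (- (u * v)))) * indicator {0<..} v * indicator {0..f} u \<partial>lborel)
          = (\<integral>\<^sup>+v. ennreal c * (ennreal (v powr ((1 - \<gamma>) - 1) * exp (- (v * u))) * indicator {0<..} v) \<partial>lborel)"
        proof (rule nn_integral_cong)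
          fix v :: real
          have "v powr (- 1 - \<gamma>) * v = v powr - \<gamma>" if "v > 0"
            using that powr_add[of v "-1-\<gamma>" 1] by simp
          then have "c * v powr (- 1 - \<gamma>) * (v * exp (- (u * v))) = c * (v powr (- \<gamma>) * exp (- (v * u)))" if "v > 0"
            using that by (simp add: mult.assoc[symmetric] mult.commute[of u v])
          then show "ennreal (c * v powr (- 1 - \<gamma>) * (v * exp (- (u * v)))) * indicator {0<..} v * indicator {0..f} u
             = ennreal c * (ennreal (v powr ((1 - \<gamma>) - 1) * exp (- (v * u))) * indicator {0<..} v)"
            using True c by (auto simp: indicator_def ennreal_mult''[symmetric])
        qed
        also have "\<dots> = ennreal c * ennreal (Gamma (1 - \<gamma>) * u powr (- (1 - \<gamma>)))"
          using \<gamma> True nn_integral_powr_exp[of "1 - \<gamma>" u] by (subst nn_integral_cmult) auto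
        also have "\<dots> = ennreal (\<gamma> * u powr (\<gamma> - 1))"
          using G c by (simp add: ennreal_mult''[symmetric] c_def)
        finally show ?thesis using True by simp
      qed (use elim in \<open>auto simp: indicator_def\<close>)
    qed
  qed
  also have "\<dots> = ennreal (f powr \<gamma>)"
    by (rule nn_integral_powr_0) (use assms in auto)
  finally show ?thesis by (simp add: c_def)
qed

lemma stable_exponent_eq:
  assumes "0 < \<gamma>" "\<gamma> < 1" "\<And>x. 0 \<le> f x"
  shows "stable_exponent \<gamma> \<alpha> f = (\<integral>\<^sup>+x. ennreal (f x powr \<gamma>) \<partial>\<alpha>)"
  unfolding stable_exponent_def using assms by (intro nn_integral_cong stable_Levy_integral)

section \<open>Boundedly finite measures\<close>

lemma space_bfm_algebra: "space bfm_algebra = {\<mu>. boundedly_finite \<mu>}"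
  unfolding bfm_algebra_def by (subst space_Sup_eq_UN) (auto intro: sets.top)

lemma sets_in_bfm_algebra: "\<mu> \<in> space bfm_algebra \<Longrightarrow> sets \<mu> = sets borel"
  by (simp add: space_bfm_algebra boundedly_finite_def)

lemma measurable_emeasure_bfm [measurable]:
  "A \<in> sets borel \<Longrightarrow> (\<lambda>\<mu>. emeasure \<mu> A) \<in> borel_measurable bfm_algebra"
  unfolding bfm_algebra_def by (rule measurable_SUP1[where i = A]) (auto intro: measurable_vimage_algebra1)

lemma measurable_nn_integral_bfm [measurable]:
  assumes "f \<in> borel_measurable borel"
  shows "(\<lambda>\<mu>. \<integral>\<^sup>+x. f x \<partial>\<mu>) \<in> borel_measurable bfm_algebra"
  using assms
proof (induction rule: borel_measurable_induct)
  case (cong f g)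
  then show ?case
    by simp
next
  case (set A)
  then show ?case
    by (subst measurable_cong[where g = "\<lambda>\<mu>. emeasure \<mu> A"]) (auto simp: sets_in_bfm_algebra)
next
  case (mult u c)
  then show ?case
    by (subst measurable_cong[where g = "\<lambda>\<mu>. c * (\<integral>\<^sup>+x. u x \<partial>\<mu>)"])
       (auto simp: nn_integral_cmult sets_in_bfm_algebra cong: measurable_cong_sets)
next
  case (add u v)
  then show ?case
    by (subst measurable_cong[where g = "\<lambda>\<mu>. (\<integral>\<^sup>+x. v x \<partial>\<mu>) + (\<integral>\<^sup>+x. u x \<partial>\<mu>)"])
       (auto simp: nn_integral_add sets_in_bfm_algebra cong: measurable_cong_sets)
next
  case (seq F)
  then show ?case
    by (subst measurable_cong[where g = "\<lambda>\<mu>. SUP i. (\<integral>\<^sup>+x. F i x \<partial>\<mu>)"])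
       (auto simp: nn_integral_monotone_convergence_SUP sets_in_bfm_algebra SUP_apply[abs_def] cong: measurable_cong_sets)
qed

lemma measurable_integral_bfm [measurable]:
  fixes f :: "'a::polish_space \<Rightarrow> real"
  assumes [measurable]: "f \<in> borel_measurable borel"
  shows "(\<lambda>\<mu>. \<integral>x. f x \<partial>\<mu>) \<in> borel_measurable bfm_algebra"
proof (subst measurable_cong)
  fix \<mu> :: "'a measure" assume "\<mu> \<in> space bfm_algebra"
  then have [measurable_cong]: "sets \<mu> = sets borel" by (rule sets_in_bfm_algebra)
  \<comment> \<open>The Bochner integral of a non-integrable function is 0 by convention, hence the
    case distinction on the measurable event of integrability.\<close>
  show "(\<integral>x. f x \<partial>\<mu>) = (if (\<integral>\<^sup>+x. ennreal (norm (f x)) \<partial>\<mu>) < \<infinity>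
      then enn2real (\<integral>\<^sup>+x. ennreal (f x) \<partial>\<mu>) - enn2real (\<integral>\<^sup>+x. ennreal (- f x) \<partial>\<mu>) else 0)"
    using real_lebesgue_integral_def[of \<mu> f] integrable_iff_bounded[of \<mu> f] not_integrable_integral_eq[of \<mu> f]
    by auto
qed measurable

text \<open>The default values agree in the degenerate cases: for mass 0 or infinity the scaled
  measure is null, while \<open>measure\<close> is 0 and the quotient is a division by 0, which
  gives 0.\<close>

lemma integral_normalized:
  fixes g :: "'a \<Rightarrow> real"
  assumes [measurable]: "g \<in> borel_measurable m"
  shows "(\<integral>x. g x \<partial>normalized m) = (\<integral>x. g x \<partial>m) / measure m (space m)"
proof (cases "emeasure m (space m) = 0 \<or> emeasure m (space m) = \<infinity>")
  case True
  have "(\<integral>x. g x \<partial>normalized m) = 0"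
  proof (rule integral_eq_zero_AE)
    show "AE x in normalized m. g x = 0"
      using True by (intro AE_I'[of "space m"])
        (auto simp: normalized_def null_sets_def space_scale_measure)
  qed
  then show ?thesis using True by (auto simp: measure_def)
next
  case False
  then obtain a where a: "emeasure m (space m) = ennreal a" "a > 0"
    by (cases "emeasure m (space m)") auto
  have "normalized m = density m (\<lambda>x. ennreal (1 / a))"
    using a by (intro measure_eqI)
      (auto simp: normalized_def emeasure_density nn_integral_cmult divide_ennreal[symmetric] ennreal_1[symmetric] simp del: ennreal_1)
  then show ?thesis
    using a by (simp add: integral_density measure_def)
qed

section \<open>Stable completely random measures\<close>

lemma exp_neg_nonneg: "0 \<le> exp_neg x" and exp_neg_le_1: "exp_neg x \<le> 1"
  by (auto simp: exp_neg_def)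

lemma exp_neg_ennreal: "0 \<le> x \<Longrightarrow> exp_neg (ennreal x) = exp (- x)"
  by (simp add: exp_neg_def)

lemma measurable_exp_neg [measurable]: "exp_neg \<in> borel_measurable borel"
  unfolding exp_neg_def[abs_def] by measurable

locale finite_stable_CRM = prob_space S + \<alpha>: finite_measure \<alpha>
  for S :: "'s measure" and \<alpha> :: "'a::polish_space measure" +
  fixes \<gamma> :: real and \<mu> :: "'s \<Rightarrow> 'a measure"
  assumes CRM: "stable_CRM S \<gamma> \<alpha> \<mu>" and \<gamma>: "0 < \<gamma>" "\<gamma> < 1"
    and sets_\<alpha> [measurable_cong]: "sets \<alpha> = sets borel"
begin

lemma measurable_CRM [measurable]: "\<mu> \<in> measurable S bfm_algebra"
  using CRM by (simp add: stable_CRM_def)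

lemma sets_CRM: "s \<in> space S \<Longrightarrow> sets (\<mu> s) = sets borel"
  using measurable_space[OF measurable_CRM] by (rule sets_in_bfm_algebra)

lemma space_CRM: "s \<in> space S \<Longrightarrow> space (\<mu> s) = UNIV"
  using sets_eq_imp_space_eq[OF sets_CRM] by simp

lemma CRM_Laplace_functional:
  assumes [measurable]: "f \<in> borel_measurable borel" and f0: "\<And>x. 0 \<le> f x"
    and f: "integrable \<alpha> (\<lambda>x. f x powr \<gamma>)"
  shows "(\<integral>s. exp_neg (\<integral>\<^sup>+x. ennreal (f x) \<partial>\<mu> s) \<partial>S) = exp (- (\<integral>x. f x powr \<gamma> \<partial>\<alpha>))"
proof -
  have "stable_exponent \<gamma> \<alpha> f = ennreal (\<integral>x. f x powr \<gamma> \<partial>\<alpha>)"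
    using f by (simp add: stable_exponent_eq[OF \<gamma> f0] nn_integral_eq_integral)
  then show ?thesis
    using CRM f0 by (simp add: stable_CRM_def exp_neg_ennreal integral_nonneg)
qed

text \<open>Scale \<open>f\<close> by factors tending to 0. The variable
  \<open>exp_neg (r * I)\<close> tends to 1 where \<open>I\<close> is finite and stays 0 where it is
  infinite, so its expectation tends to the probability of finiteness; the Laplace functional shows
  that this limit is 1.\<close>

lemma AE_CRM_finite:
  assumes [measurable]: "f \<in> borel_measurable borel" and f0: "\<And>x. 0 \<le> f x"
    and f: "integrable \<alpha> (\<lambda>x. f x powr \<gamma>)"
  shows "AE s in S. (\<integral>\<^sup>+x. ennreal (f x) \<partial>\<mu> s) < \<infinity>"
proof -
  define I where "I s = (\<integral>\<^sup>+x. ennreal (f x) \<partial>\<mu> s)" for s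
  have I[measurable]: "I \<in> borel_measurable S" unfolding I_def[abs_def] by measurable
  define c where "c = (\<integral>x. f x powr \<gamma> \<partial>\<alpha>)"
  define r where "r n = inverse (real (Suc n))" for n
  have r: "r n > 0" for n by (simp add: r_def)
  have r0: "r \<longlonglongrightarrow> 0" unfolding r_def[abs_def] by (rule LIMSEQ_inverse_real_of_nat)
  have eq: "(\<integral>s. exp_neg (ennreal (r n) * I s) \<partial>S) = exp (- (r n powr \<gamma> * c))" for n
  proof -
    have "(\<integral>s. exp_neg (ennreal (r n) * I s) \<partial>S) = (\<integral>s. exp_neg (\<integral>\<^sup>+x. ennreal (r n * f x) \<partial>\<mu> s) \<partial>S)"
    proof (intro Bochner_Integration.integral_cong refl)
      fix s assume "s \<in> space S"
      then have [measurable_cong]: "sets (\<mu> s) = sets borel" by (rule sets_CRM)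
      have "(\<integral>\<^sup>+x. ennreal (r n * f x) \<partial>\<mu> s) = ennreal (r n) * I s"
        using r[of n] f0 by (simp add: ennreal_mult I_def nn_integral_cmult)
      then show "exp_neg (ennreal (r n) * I s) = exp_neg (\<integral>\<^sup>+x. ennreal (r n * f x) \<partial>\<mu> s)" by simp
    qed
    also have "\<dots> = exp (- (\<integral>x. (r n * f x) powr \<gamma> \<partial>\<alpha>))"
      using r[of n] f0 f by (intro CRM_Laplace_functional) (auto simp: powr_mult)
    also have "(\<integral>x. (r n * f x) powr \<gamma> \<partial>\<alpha>) = r n powr \<gamma> * c"
      using r[of n] f0 by (simp add: powr_mult c_def)
    finally show ?thesis .
  qed
  have "(\<lambda>n. \<integral>s. exp_neg (ennreal (r n) * I s) \<partial>S) \<longlonglongrightarrow> (\<integral>s. indicator {s\<in>space S. I s < \<infinity>} s \<partial>S)"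
  proof (rule integral_dominated_convergence[where w = "\<lambda>_. 1"])
    show "AE s in S. (\<lambda>n. exp_neg (ennreal (r n) * I s)) \<longlonglongrightarrow> indicator {s\<in>space S. I s < \<infinity>} s"
    proof (rule AE_I2)
      fix s assume s: "s \<in> space S"
      show "(\<lambda>n. exp_neg (ennreal (r n) * I s)) \<longlonglongrightarrow> indicator {s\<in>space S. I s < \<infinity>} s"
      proof (cases "I s")
        case (real a)
        have "exp_neg (ennreal (r n) * I s) = exp (- (r n * a))" for n
          using real r[of n] by (simp add: ennreal_mult'[symmetric] exp_neg_ennreal)
        moreover have "(\<lambda>n. exp (- (r n * a))) \<longlonglongrightarrow> exp (- (0 * a))"
          by (intro tendsto_intros r0)
        ultimately show ?thesis using real s by simp
      next
        case top
        then have "exp_neg (ennreal (r n) * I s) = 0" for n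
          using r[of n] by (simp add: ennreal_mult_top exp_neg_def)
        then show ?thesis using top by simp
      qed
    qed
  qed (auto simp: exp_neg_nonneg exp_neg_le_1)
  moreover have "(\<lambda>n. exp (- (r n powr \<gamma> * c))) \<longlonglongrightarrow> exp (- (0 * c))"
  proof -
    have "(\<lambda>n. r n powr \<gamma>) \<longlonglongrightarrow> 0"
      using \<gamma> r0 r by (intro tendsto_zero_powrI[where b = \<gamma>]) (auto simp: less_imp_le)
    then show ?thesis by (intro tendsto_intros)
  qed
  ultimately have "measure S {s\<in>space S. I s < \<infinity>} = 1"
    unfolding eq by (auto dest: LIMSEQ_unique)
  then show ?thesis
    by (subst (asm) prob_Collect_eq_1) (auto simp: I_def)
qed

lemma CRM_Laplace:
  assumes [measurable]: "f \<in> borel_measurable borel" and f0: "\<And>x. 0 \<le> f x"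
    and f: "integrable \<alpha> (\<lambda>x. f x powr \<gamma>)"
  shows "AE s in S. integrable (\<mu> s) f"
    and "(\<integral>s. exp (- (\<integral>x. f x \<partial>\<mu> s)) \<partial>S) = exp (- (\<integral>x. f x powr \<gamma> \<partial>\<alpha>))"
proof -
  show AE: "AE s in S. integrable (\<mu> s) f"
    using AE_CRM_finite[OF assms] AE_space
  proof eventually_elim
    case (elim s)
    from sets_CRM[OF elim(2)] have [measurable_cong]: "sets (\<mu> s) = sets borel" .
    show ?case using elim f0 by (intro integrableI_nonneg) auto
  qed
  have "(\<integral>s. exp (- (\<integral>x. f x \<partial>\<mu> s)) \<partial>S) = (\<integral>s. exp_neg (\<integral>\<^sup>+x. ennreal (f x) \<partial>\<mu> s) \<partial>S)"
  proof (rule integral_cong_AE)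
    show "AE s in S. exp (- (\<integral>x. f x \<partial>\<mu> s)) = exp_neg (\<integral>\<^sup>+x. ennreal (f x) \<partial>\<mu> s)"
      using AE by eventually_elim (simp add: nn_integral_eq_integral f0 exp_neg_ennreal integral_nonneg)
  qed auto
  also have "\<dots> = exp (- (\<integral>x. f x powr \<gamma> \<partial>\<alpha>))"
    by (rule CRM_Laplace_functional[OF assms])
  finally show "(\<integral>s. exp (- (\<integral>x. f x \<partial>\<mu> s)) \<partial>S) = exp (- (\<integral>x. f x powr \<gamma> \<partial>\<alpha>))" .
qed

lemma AE_CRM_mass_finite: "AE s in S. emeasure (\<mu> s) UNIV < \<infinity>"
proof -
  have "AE s in S. (\<integral>\<^sup>+x. ennreal 1 \<partial>\<mu> s) < \<infinity>" by (rule AE_CRM_finite) auto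
  then show ?thesis using AE_space by eventually_elim (simp add: space_CRM)
qed

lemma CRM_mass_Laplace:
  assumes "0 \<le> u"
  shows "(\<integral>s. exp (- (u * measure (\<mu> s) UNIV)) \<partial>S) = exp (- (u powr \<gamma> * measure \<alpha> UNIV))"
proof -
  have "(\<integral>s. exp (- (u * measure (\<mu> s) UNIV)) \<partial>S) = (\<integral>s. exp (- (\<integral>x. u \<partial>\<mu> s)) \<partial>S)"
    by (intro Bochner_Integration.integral_cong) (auto simp: space_CRM mult.commute)
  also have "\<dots> = exp (- (\<integral>x. u powr \<gamma> \<partial>\<alpha>))"
    using assms by (intro CRM_Laplace) auto
  finally show ?thesis
    using sets_eq_imp_space_eq[OF sets_\<alpha>] by (simp add: mult.commute)
qed

text \<open>The opposite limit: as the factor \<open>n\<close> grows, \<open>exp (- (n * M))\<close>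
  retains only the event \<open>M = 0\<close>, and the Laplace transform tends to 0 because
  \<open>\<alpha>\<close> has positive mass.\<close>

lemma AE_CRM_mass_pos:
  assumes "0 < emeasure \<alpha> UNIV"
  shows "AE s in S. 0 < measure (\<mu> s) UNIV"
proof -
  have a: "0 < measure \<alpha> UNIV"
    using assms by (simp add: \<alpha>.emeasure_eq_measure)
  have [measurable]: "(\<lambda>s. measure (\<mu> s) UNIV) \<in> borel_measurable S"
    unfolding measure_def by measurable
  have "(\<lambda>n. \<integral>s. exp (- (real n * measure (\<mu> s) UNIV)) \<partial>S) \<longlonglongrightarrow> (\<integral>s. indicator {s\<in>space S. measure (\<mu> s) UNIV = 0} s \<partial>S)"
  proof (rule integral_dominated_convergence[where w = "\<lambda>_. 1"])
    show "AE s in S. (\<lambda>n. exp (- (real n * measure (\<mu> s) UNIV))) \<longlonglongrightarrow> indicator {s\<in>space S. measure (\<mu> s) UNIV = 0} s"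
    proof (rule AE_I2)
      fix s assume s: "s \<in> space S"
      show "(\<lambda>n. exp (- (real n * measure (\<mu> s) UNIV))) \<longlonglongrightarrow> indicator {s\<in>space S. measure (\<mu> s) UNIV = 0} s"
      proof (cases "measure (\<mu> s) UNIV = 0")
        case False
        then have "0 < measure (\<mu> s) UNIV" by (simp add: zero_less_measure_iff)
        then have "(\<lambda>n. exp (- (real n * measure (\<mu> s) UNIV))) \<longlonglongrightarrow> 0" by real_asymp
        then show ?thesis using False by simp
      qed (use s in simp)
    qed
  qed auto
  moreover have "(\<lambda>n. exp (- (real n powr \<gamma> * measure \<alpha> UNIV))) \<longlonglongrightarrow> 0"
    using a \<gamma> by real_asymp
  ultimately have "measure S {s\<in>space S. measure (\<mu> s) UNIV = 0} = 0"
    by (auto simp: CRM_mass_Laplace dest: LIMSEQ_unique)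
  then have "AE s in S. measure (\<mu> s) UNIV \<noteq> 0"
    by (subst (asm) prob_eq_0) auto
  then show ?thesis by eventually_elim (simp add: zero_less_measure_iff)
qed

end

section \<open>Complex powers and stretched exponentials\<close>

lemma norm_powr_complex_of_real:
  fixes w :: complex
  assumes "w \<noteq> 0"
  shows "norm (w powr of_real r) = norm w powr r"
  using assms by (simp add: powr_def)

text \<open>A positive factor leaves the argument of \<open>w\<close> unchanged, so the principal
  branch is multiplicative here.\<close>

lemma powr_of_real_mult:
  fixes w :: complex
  assumes "0 < r" "w \<noteq> 0"
  shows "(of_real r * w) powr a = of_real r powr a * w powr a"
  using assms by (simp add: powr_def Ln_times_of_real exp_add distrib_left)

text \<open>In the right half-plane the principal argument is \<open>arctan (Im w / Re w)\<close>;
  all arctangents in the final formula come from here.\<close>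

lemma Re_Im_powr_of_real:
  fixes w :: complex
  assumes "0 < Re w"
  shows "Re (w powr of_real r) = norm w powr r * cos (r * arctan (Im w / Re w))"
    and "Im (w powr of_real r) = norm w powr r * sin (r * arctan (Im w / Re w))"
proof -
  have w: "w \<noteq> 0" using assms by auto
  have "Im (Ln w) = arctan (Im w / Re w)"
    using assms w by (subst Im_Ln_eq) auto
  then show "Re (w powr of_real r) = norm w powr r * cos (r * arctan (Im w / Re w))"
    "Im (w powr of_real r) = norm w powr r * sin (r * arctan (Im w / Re w))"
    using w by (simp_all add: powr_def Re_exp Im_exp mult.commute)
qed

text \<open>The substitution by \<open>c = K powr (- 1 / \<gamma>)\<close> normalises the rate to 1,
  since \<open>K * (c * u) powr \<gamma> = u powr \<gamma>\<close>. Integrability at rate 1 is a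
  hypothesis; the mass of the tilted law will supply it.\<close>

lemma has_bochner_integral_stretched_exp:
  fixes K \<gamma> \<theta> :: real
  assumes K: "0 < K" and \<gamma>: "0 < \<gamma>"
    and int: "set_integrable lborel {0<..} (\<lambda>u. u powr (\<theta> - 1) * exp (- (u powr \<gamma>)))"
  shows "has_bochner_integral lborel (\<lambda>u. indicator {0<..} u * u powr (\<theta> - 1) * exp (- (K * u powr \<gamma>)))
    (K powr (- \<theta> / \<gamma>) * (LBINT u:{0<..}. u powr (\<theta> - 1) * exp (- (u powr \<gamma>))))"
proof -
  define c where "c = K powr (- 1 / \<gamma>)"
  have c: "c > 0" using K by (simp add: c_def)
  have cg: "K * c powr \<gamma> = 1"
  proof -
    have "c powr \<gamma> = K powr (- 1)" unfolding c_def powr_powr using \<gamma> by simp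
    then show ?thesis using K by (simp add: powr_minus)
  qed
  have ct: "c powr \<theta> = K powr (- \<theta> / \<gamma>)" by (simp add: c_def powr_powr)
  define f where "f u = indicator {0<..} u * u powr (\<theta> - 1) * exp (- (K * u powr \<gamma>))" for u :: real
  define g where "g u = indicator {0<..} u * (u powr (\<theta> - 1) * exp (- (u powr \<gamma>)))" for u :: real
  have fg: "f (0 + c * u) = c powr (\<theta> - 1) * g u" for u
  proof (cases "u > 0")
    case True
    have "K * (c * u) powr \<gamma> = u powr \<gamma>"
      using True c cg by (simp add: powr_mult mult.assoc[symmetric])
    then show ?thesis using True c by (simp add: f_def g_def powr_mult)
  qed (use c in \<open>auto simp: f_def g_def zero_less_mult_iff\<close>)
  have ig: "integrable lborel g" using int by (simp add: set_integrable_def g_def[abs_def])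
  have "has_bochner_integral lborel (\<lambda>u. f (0 + c * u)) (c powr (\<theta> - 1) * integral\<^sup>L lborel g)"
    unfolding fg using ig by (intro has_bochner_integral_mult_right has_bochner_integral_integrable)
  then have "has_bochner_integral lborel f (\<bar>c\<bar> *\<^sub>R (c powr (\<theta> - 1) * integral\<^sup>L lborel g))"
    using c lborel_has_bochner_integral_real_affine_iff[of c f "\<bar>c\<bar> *\<^sub>R (c powr (\<theta> - 1) * integral\<^sup>L lborel g)" 0]
    by (simp add: mult.assoc[symmetric])
  also have "\<bar>c\<bar> *\<^sub>R (c powr (\<theta> - 1) * integral\<^sup>L lborel g) = K powr (- \<theta> / \<gamma>) * integral\<^sup>L lborel g"
    unfolding ct[symmetric] using c by (simp add: powr_diff)
  finally show ?thesis
    by (simp add: f_def[abs_def] g_def[abs_def] set_lebesgue_integral_def)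
qed

text \<open>Both sides are holomorphic in \<open>K\<close> on the right half-plane and agree on the
  positive reals, which accumulate at 1.\<close>

lemma integral_stretched_exp:
  fixes K :: complex and \<gamma> \<theta> :: real
  assumes K: "0 < Re K" and \<gamma>: "0 < \<gamma>"
    and int: "set_integrable lborel {0<..} (\<lambda>u. u powr (\<theta> - 1) * exp (- (u powr \<gamma>)))"
  shows "(CLBINT u. of_real (indicator {0<..} u * u powr (\<theta> - 1)) * exp (- (K * of_real (u powr \<gamma>))))
    = K powr of_real (- \<theta> / \<gamma>) * of_real (LBINT u:{0<..}. u powr (\<theta> - 1) * exp (- (u powr \<gamma>)))"
proof -
  let ?w = "\<lambda>u::real. indicator {0<..} u * u powr (\<theta> - 1)"
  let ?C = "LBINT u:{0<..}. u powr (\<theta> - 1) * exp (- (u powr \<gamma>))"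
  let ?F = "\<lambda>K. CLBINT u. of_real (?w u) * exp (- (K * of_real (u powr \<gamma>)))"
  have "?F K - K powr of_real (- \<theta> / \<gamma>) * of_real ?C = 0"
  proof (rule analytic_continuation[where f = "\<lambda>K. ?F K - K powr of_real (- \<theta> / \<gamma>) * of_real ?C" and S = "{z. Re z \<in> {0<..}}" and U = "of_real ` {0<..}" and \<xi> = 1])
    have "?F holomorphic_on {z. Re z \<in> {0<..}}"
      using has_bochner_integral_stretched_exp[OF _ \<gamma> int]
      by (intro holomorphic_on_laplace) (auto simp: has_bochner_integral_iff)
    then show "(\<lambda>K. ?F K - K powr of_real (- \<theta> / \<gamma>) * of_real ?C) holomorphic_on {z. Re z \<in> {0<..}}"
      by (intro holomorphic_intros) (auto simp: complex_nonpos_Reals_iff)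
    show "open {z. Re z \<in> {0<..}}" using open_halfspace_Re_gt[of 0] by simp
    show "connected {z. Re z \<in> {0<..}}"
      using convex_halfspace_Re_gt[of 0] by (intro convex_connected) simp
    show "(1::complex) islimpt of_real ` {0<..}"
      unfolding islimpt_approachable
    proof (intro allI impI)
      fix e :: real assume "e > 0"
      moreover have "dist (of_real (1 + e / 2)) (1::complex) = dist (1 + e / 2) 1"
        by (metis dist_of_real of_real_1)
      ultimately show "\<exists>x'\<in>of_real ` {0<..}. x' \<noteq> (1::complex) \<and> dist x' 1 < e"
        by (intro bexI[of _ "of_real (1 + e / 2)"]) (auto simp: dist_real_def simp del: of_real_add)
    qed
    show "?F z - z powr of_real (- \<theta> / \<gamma>) * of_real ?C = 0" if zU: "z \<in> of_real ` {0<..}" for z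
    proof -
      obtain k where k: "z = of_real k" "k > 0" using zU by auto
      have "?F z = (CLBINT u. of_real (indicator {0<..} u * u powr (\<theta> - 1) * exp (- (k * u powr \<gamma>))))"
        by (simp add: k exp_of_real[symmetric])
      also have "\<dots> = of_real (k powr (- \<theta> / \<gamma>) * ?C)"
        using has_bochner_integral_stretched_exp[OF k(2) \<gamma> int]
        by (subst integral_complex_of_real) (simp add: has_bochner_integral_iff)
      finally have F: "?F z = of_real (k powr (- \<theta> / \<gamma>) * ?C)" .
      have "z powr of_real (- \<theta> / \<gamma>) = of_real (k powr (- \<theta> / \<gamma>))"
        unfolding k(1) using k(2) by (intro powr_of_real) auto
      then show ?thesis unfolding F by (simp only: of_real_mult diff_self)
    qed
  qed (use K in auto)
  then show ?thesis by simp
qed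

section \<open>Integrals of powers of affine functions of h\<close>

lemma powr_add_le:
  fixes a b \<gamma> :: real
  assumes "0 \<le> a" "0 \<le> b" "0 \<le> \<gamma>"
  shows "(a + b) powr \<gamma> \<le> 2 powr \<gamma> * (a powr \<gamma> + b powr \<gamma>)"
proof -
  have "(a + b) powr \<gamma> \<le> (2 * max a b) powr \<gamma>" using assms by (intro powr_mono2) auto
  also have "\<dots> = 2 powr \<gamma> * max a b powr \<gamma>" using assms by (simp add: powr_mult)
  also have "max a b powr \<gamma> \<le> a powr \<gamma> + b powr \<gamma>" by (auto simp: max_def)
  finally show ?thesis by simp
qed

lemma (in finite_measure) integrable_powr_affine:
  fixes h :: "'a \<Rightarrow> real"
  assumes [measurable]: "h \<in> borel_measurable M" and h: "integrable M (\<lambda>x. \<bar>h x\<bar> powr \<gamma>)"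
    and "0 \<le> a" "0 \<le> b" "0 \<le> \<gamma>"
  shows "integrable M (\<lambda>x. (a + b * \<bar>h x\<bar>) powr \<gamma>)"
proof (rule Bochner_Integration.integrable_bound)
  show "integrable M (\<lambda>x. 2 powr \<gamma> * (a powr \<gamma> + b powr \<gamma> * \<bar>h x\<bar> powr \<gamma>))"
    using h by (intro integrable_mult_right Bochner_Integration.integrable_add) auto
  show "AE x in M. norm ((a + b * \<bar>h x\<bar>) powr \<gamma>) \<le> norm (2 powr \<gamma> * (a powr \<gamma> + b powr \<gamma> * \<bar>h x\<bar> powr \<gamma>))"
    using powr_add_le[of a "b * \<bar>h _\<bar>" \<gamma>] assms by (intro AE_I2) (auto simp: powr_mult)
qed measurable

lemma (in finite_measure) integrable_cpowr_affine:
  fixes h :: "'a \<Rightarrow> real" and z :: complex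
  assumes [measurable]: "h \<in> borel_measurable M" and h: "integrable M (\<lambda>x. \<bar>h x\<bar> powr \<gamma>)"
    and "0 \<le> u" "0 \<le> \<epsilon>" "0 \<le> \<gamma>" 
  shows "integrable M (\<lambda>x. (of_real (u + \<epsilon> * \<bar>h x\<bar>) + z * of_real (h x)) powr (of_real \<gamma> :: complex))"
proof (rule Bochner_Integration.integrable_bound)
  show "integrable M (\<lambda>x. (u + (\<epsilon> + norm z) * \<bar>h x\<bar>) powr \<gamma>)"
    using assms by (intro integrable_powr_affine) auto
  show "AE x in M. norm ((of_real (u + \<epsilon> * \<bar>h x\<bar>) + z * of_real (h x)) powr (of_real \<gamma> :: complex))
    \<le> norm ((u + (\<epsilon> + norm z) * \<bar>h x\<bar>) powr \<gamma>)"
  proof (rule AE_I2)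
    fix x
    let ?w = "of_real (u + \<epsilon> * \<bar>h x\<bar>) + z * of_real (h x)"
    have "norm ?w \<le> norm (complex_of_real (u + \<epsilon> * \<bar>h x\<bar>)) + norm (z * of_real (h x))"
      by (rule norm_triangle_ineq)
    also have "\<dots> = u + (\<epsilon> + norm z) * \<bar>h x\<bar>"
      using assms by (simp only: norm_of_real norm_mult) (simp add: distrib_right)
    finally have "norm ?w powr \<gamma> \<le> (u + (\<epsilon> + norm z) * \<bar>h x\<bar>) powr \<gamma>"
      using assms by (intro powr_mono2) auto
    then show "norm (?w powr (of_real \<gamma> :: complex)) \<le> norm ((u + (\<epsilon> + norm z) * \<bar>h x\<bar>) powr \<gamma>)"
      by (cases "?w = 0") (auto simp: norm_powr_complex_of_real)
  qed
qed measurable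

text \<open>For \<open>\<bar>Re z\<bar> < \<epsilon>\<close> the term
  \<open>\<epsilon> * \<bar>h x\<bar>\<close> outweighs the real part of \<open>z * h x\<close>, so
  the base stays off the branch cut, with real part at least
  \<open>u + \<delta> * \<bar>h x\<bar>\<close>. As \<open>\<gamma> < 1\<close>, the power
  \<open>\<gamma> - 1\<close> decreases in the modulus of the base, and the factor
  \<open>h x\<close> of the derivative is absorbed into the integrable
  \<open>(u + \<delta> * \<bar>h x\<bar>) powr \<gamma>\<close>.\<close>

lemma (in finite_measure) holomorphic_on_integral_powr:
  fixes h :: "'a \<Rightarrow> real"
  assumes [measurable]: "h \<in> borel_measurable M" and h: "integrable M (\<lambda>x. \<bar>h x\<bar> powr \<gamma>)"
    and u: "0 < u" and \<gamma>: "0 < \<gamma>" "\<gamma> < 1"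
  shows "(\<lambda>z. \<integral>x. (of_real (u + \<epsilon> * \<bar>h x\<bar>) + z * of_real (h x)) powr (of_real \<gamma> :: complex) \<partial>M)
    holomorphic_on {z. Re z \<in> {- \<epsilon><..<\<epsilon>}}"
proof -
  let ?w = "\<lambda>x z. of_real (u + \<epsilon> * \<bar>h x\<bar>) + z * complex_of_real (h x)"
  have op: "open {z. Re z \<in> {- \<epsilon><..<\<epsilon>}}"
    using open_vimage[OF open_greaterThanLessThan continuous_on_Re[OF continuous_on_id]] by (simp add: vimage_def)
  have "\<exists>D. ((\<lambda>z. \<integral>x. ?w x z powr (of_real \<gamma> :: complex) \<partial>M) has_field_derivative D) (at z)"
    if z: "Re z \<in> {- \<epsilon><..<\<epsilon>}" for z
  proof -
    \<comment> \<open>Half the distance from \<open>\<bar>Re z\<bar>\<close> to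
      \<open>\<epsilon>\<close>: on the ball of this radius
      \<open>\<bar>Re y\<bar> \<le> \<epsilon> - \<delta>\<close> still holds, and the remaining
      \<open>\<delta> * \<bar>h x\<bar>\<close> is the margin in \<open>Re_w\<close>.\<close>
    define \<delta> where "\<delta> = (\<epsilon> - \<bar>Re z\<bar>) / 2"
    have \<delta>: "\<delta> > 0" "\<bar>Re z\<bar> + \<delta> = \<epsilon> - \<delta>" using z by (auto simp: \<delta>_def field_simps)
    have Re_w: "u + \<delta> * \<bar>h x\<bar> \<le> Re (?w x y)" if "y \<in> ball z \<delta>" for x y
    proof -
      have "\<bar>Re y - Re z\<bar> \<le> dist y z"
        using abs_Re_le_cmod[of "y - z"] by (simp add: dist_norm)
      then have "\<bar>Re y\<bar> \<le> \<epsilon> - \<delta>" using that \<delta> by (auto simp: dist_commute)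
      then have "\<bar>Re y * h x\<bar> \<le> (\<epsilon> - \<delta>) * \<bar>h x\<bar>"
        unfolding abs_mult by (intro mult_right_mono) auto
      then show ?thesis by (simp add: algebra_simps abs_le_iff)
    qed
    have pos: "0 < u + \<delta> * \<bar>h x\<bar>" for x using u \<delta> by (intro add_pos_nonneg) auto
    have "((\<lambda>z. \<integral>x. ?w x z powr (of_real \<gamma> :: complex) \<partial>M) has_field_derivative
        (\<integral>x. of_real \<gamma> * ?w x z powr (of_real \<gamma> - 1) * of_real (h x) \<partial>M)) (at z)"
    proof (rule has_field_derivative_integral[where U = "ball z \<delta>" and w = "\<lambda>x. \<gamma> / \<delta> * (u + \<delta> * \<bar>h x\<bar>) powr \<gamma>"])
      show "integrable M (\<lambda>x. ?w x y powr (of_real \<gamma> :: complex))" if "y \<in> ball z \<delta>" for y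
        using assms z by (intro integrable_cpowr_affine) auto
      show "integrable M (\<lambda>x. \<gamma> / \<delta> * (u + \<delta> * \<bar>h x\<bar>) powr \<gamma>)"
        using assms \<delta> by (intro integrable_mult_right integrable_powr_affine) auto
      fix x y assume y: "y \<in> ball z \<delta>"
      have Re0: "0 < Re (?w x y)" using Re_w[OF y, of x] pos[of x] by linarith
      then have w0: "?w x y \<noteq> 0" by (metis less_irrefl zero_complex.sel(1))
      show "((\<lambda>z. ?w x z powr (of_real \<gamma> :: complex)) has_field_derivative
        of_real \<gamma> * ?w x y powr (of_real \<gamma> - 1) * of_real (h x)) (at y)"
        using Re0 by (auto intro!: derivative_eq_intros simp: complex_nonpos_Reals_iff)
      have "norm (of_real \<gamma> * ?w x y powr (of_real \<gamma> - 1) * of_real (h x)) = \<gamma> * norm (?w x y) powr (\<gamma> - 1) * \<bar>h x\<bar>"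
        using norm_powr_complex_of_real[OF w0, of "\<gamma> - 1"] \<gamma> by (simp only: norm_mult norm_of_real) simp
      also have "\<dots> \<le> \<gamma> * (u + \<delta> * \<bar>h x\<bar>) powr (\<gamma> - 1) * ((u + \<delta> * \<bar>h x\<bar>) / \<delta>)"
      proof (intro mult_mono)
        have "u + \<delta> * \<bar>h x\<bar> \<le> norm (?w x y)"
          using Re_w[OF y, of x] complex_Re_le_cmod[of "?w x y"] by linarith
        then show "norm (?w x y) powr (\<gamma> - 1) \<le> (u + \<delta> * \<bar>h x\<bar>) powr (\<gamma> - 1)"
          using \<gamma> pos[of x] by (intro powr_mono2') auto
        show "\<bar>h x\<bar> \<le> (u + \<delta> * \<bar>h x\<bar>) / \<delta>" using u \<delta> by (simp add: field_simps)
      qed (use \<gamma> in auto)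
      also have "\<dots> = \<gamma> / \<delta> * (u + \<delta> * \<bar>h x\<bar>) powr \<gamma>"
        using pos[of x] powr_add[of "u + \<delta> * \<bar>h x\<bar>" "\<gamma> - 1" 1] by simp
      finally show "norm (of_real \<gamma> * ?w x y powr (of_real \<gamma> - 1) * of_real (h x)) \<le> \<gamma> / \<delta> * (u + \<delta> * \<bar>h x\<bar>) powr \<gamma>" .
    qed (use \<delta> in auto)
    then show ?thesis by blast
  qed
  then show ?thesis
    unfolding holomorphic_on_open[OF op] by simp
qed

section \<open>The joint characteristic function of mean and mass\<close>

context finite_stable_CRM
begin

lemma measurable_CRM_mass [measurable]: "(\<lambda>s. measure (\<mu> s) UNIV) \<in> borel_measurable S"
  unfolding measure_def by measurable

lemma measurable_CRM_integral [measurable]: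
  fixes f :: "'a \<Rightarrow> real"
  assumes [measurable]: "f \<in> borel_measurable borel"
  shows "(\<lambda>s. \<integral>x. f x \<partial>\<mu> s) \<in> borel_measurable S"
  by (rule measurable_compose[OF measurable_CRM measurable_integral_bfm]) fact

lemma AE_CRM_integrable:
  fixes h :: "'a \<Rightarrow> real"
  assumes [measurable]: "h \<in> borel_measurable borel"
    and h: "integrable \<alpha> (\<lambda>x. \<bar>h x\<bar> powr \<gamma>)"
  shows "AE s in S. integrable (\<mu> s) h"
proof -
  have "AE s in S. integrable (\<mu> s) (\<lambda>x. \<bar>h x\<bar>)" using h by (intro CRM_Laplace) auto
  then show ?thesis using AE_space
  proof eventually_elim
    case (elim s)
    from sets_CRM[OF elim(2)] have [measurable_cong]: "sets (\<mu> s) = sets borel" .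
    show ?case using elim by (intro integrable_abs_cancel[of _ h]) auto
  qed
qed

lemma CRM_Laplace_strip:
  fixes h :: "'a \<Rightarrow> real"
  assumes [measurable]: "h \<in> borel_measurable borel"
    and h: "integrable \<alpha> (\<lambda>x. \<bar>h x\<bar> powr \<gamma>)" and u: "0 < u" and z: "Re z \<in> {- \<epsilon><..<\<epsilon>}"
  shows "(CLINT s|S. of_real (exp (- (u * measure (\<mu> s) UNIV + \<epsilon> * (\<integral>x. \<bar>h x\<bar> \<partial>\<mu> s)))) * exp (- (z * of_real (\<integral>x. h x \<partial>\<mu> s))))
    = exp (- (CLINT x|\<alpha>. (of_real (u + \<epsilon> * \<bar>h x\<bar>) + z * of_real (h x)) powr of_real \<gamma>))"
proof -
  let ?w = "\<lambda>s. exp (- (u * measure (\<mu> s) UNIV + \<epsilon> * (\<integral>x. \<bar>h x\<bar> \<partial>\<mu> s)))"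
  let ?X = "\<lambda>s. \<integral>x. h x \<partial>\<mu> s"
  let ?L = "\<lambda>z. CLINT s|S. of_real (?w s) * exp (- (z * of_real (?X s)))"
  let ?R = "\<lambda>z. CLINT x|\<alpha>. (of_real (u + \<epsilon> * \<bar>h x\<bar>) + z * of_real (h x)) powr of_real \<gamma>"
  let ?D = "{z. Re z \<in> {- \<epsilon><..<\<epsilon>}}"
  have \<epsilon>: "0 < \<epsilon>" using z by auto
  have nonneg: "0 \<le> u + \<epsilon> * \<bar>h x\<bar> + c * h x" if "c \<in> {- \<epsilon><..<\<epsilon>}" for c x
  proof -
    have "\<bar>c * h x\<bar> \<le> \<epsilon> * \<bar>h x\<bar>" unfolding abs_mult using that by (intro mult_right_mono) auto
    then show ?thesis using u by (simp add: abs_le_iff)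
  qed
  have AE: "AE s in S. ?w s * exp (- (c * ?X s)) = exp (- (\<integral>x. u + \<epsilon> * \<bar>h x\<bar> + c * h x \<partial>\<mu> s))" for c
    using AE_CRM_integrable[OF assms(1) h] AE_CRM_mass_finite AE_space
  proof eventually_elim
    case (elim s)
    interpret m: finite_measure "\<mu> s"
      using elim by (intro finite_measureI) (auto simp: space_CRM)
    have "(\<integral>x. u + \<epsilon> * \<bar>h x\<bar> + c * h x \<partial>\<mu> s) = u * measure (\<mu> s) UNIV + \<epsilon> * (\<integral>x. \<bar>h x\<bar> \<partial>\<mu> s) + c * ?X s"
      using elim(1) by (simp add: Bochner_Integration.integral_add integrable_abs space_CRM[OF elim(3)] mult.commute)
    then show ?case by (simp add: exp_add[symmetric])
  qed
  \<comment> \<open>The damped exponential is \<open>exp\<close> of minus the integral of a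
    nonnegative function, hence at most 1.\<close>
  have int: "integrable S (\<lambda>s. ?w s * exp (- (c * ?X s)))" if c: "c \<in> {- \<epsilon><..<\<epsilon>}" for c
  proof (rule integrable_const_bound[where B = 1])
    show "AE s in S. norm (?w s * exp (- (c * ?X s))) \<le> 1"
      using AE[of c] AE_space
    proof eventually_elim
      case (elim s)
      show ?case unfolding elim(1) using nonneg[OF c] by (auto intro: integral_nonneg)
    qed
  qed measurable
  have eq: "(\<integral>s. ?w s * exp (- (c * ?X s)) \<partial>S) = exp (- (\<integral>x. (u + \<epsilon> * \<bar>h x\<bar> + c * h x) powr \<gamma> \<partial>\<alpha>))"
    and int\<alpha>: "integrable \<alpha> (\<lambda>x. (u + \<epsilon> * \<bar>h x\<bar> + c * h x) powr \<gamma>)"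
    if c: "c \<in> {- \<epsilon><..<\<epsilon>}" for c
  proof -
    show i: "integrable \<alpha> (\<lambda>x. (u + \<epsilon> * \<bar>h x\<bar> + c * h x) powr \<gamma>)"
    proof (rule Bochner_Integration.integrable_bound)
      show "integrable \<alpha> (\<lambda>x. (u + (\<epsilon> + \<bar>c\<bar>) * \<bar>h x\<bar>) powr \<gamma>)"
        using u \<epsilon> \<gamma> h by (intro \<alpha>.integrable_powr_affine) auto
      show "AE x in \<alpha>. norm ((u + \<epsilon> * \<bar>h x\<bar> + c * h x) powr \<gamma>) \<le> norm ((u + (\<epsilon> + \<bar>c\<bar>) * \<bar>h x\<bar>) powr \<gamma>)"
      proof (rule AE_I2)
        fix x
        have "u + \<epsilon> * \<bar>h x\<bar> + c * h x \<le> u + (\<epsilon> + \<bar>c\<bar>) * \<bar>h x\<bar>"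
          using abs_ge_self[of "c * h x"] by (simp add: abs_mult distrib_right)
        then show "norm ((u + \<epsilon> * \<bar>h x\<bar> + c * h x) powr \<gamma>) \<le> norm ((u + (\<epsilon> + \<bar>c\<bar>) * \<bar>h x\<bar>) powr \<gamma>)"
          using nonneg[OF c, of x] \<gamma> by (auto intro!: powr_mono2)
      qed
    qed measurable
    have "(\<integral>s. ?w s * exp (- (c * ?X s)) \<partial>S) = (\<integral>s. exp (- (\<integral>x. u + \<epsilon> * \<bar>h x\<bar> + c * h x \<partial>\<mu> s)) \<partial>S)"
      by (rule integral_cong_AE) (use AE[of c] in auto)
    also have "\<dots> = exp (- (\<integral>x. (u + \<epsilon> * \<bar>h x\<bar> + c * h x) powr \<gamma> \<partial>\<alpha>))"
      using nonneg[OF c] i by (intro CRM_Laplace) auto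
    finally show "(\<integral>s. ?w s * exp (- (c * ?X s)) \<partial>S) = exp (- (\<integral>x. (u + \<epsilon> * \<bar>h x\<bar> + c * h x) powr \<gamma> \<partial>\<alpha>))" .
  qed
  \<comment> \<open>For real \<open>z\<close> in the strip the integrand is nonnegative, so the Laplace functional applies there;
      the term \<open>\<epsilon> * \<bar>h\<bar>\<close> is what makes room for an open strip.\<close>
  have "?L z - exp (- ?R z) = 0"
  proof (rule analytic_continuation[where f = "\<lambda>z. ?L z - exp (- ?R z)" and S = ?D and U = "of_real ` {- \<epsilon><..<\<epsilon>}" and \<xi> = 0])
    have "?L holomorphic_on ?D"
      using int by (intro holomorphic_on_laplace) auto
    moreover have "?R holomorphic_on ?D"
      using u \<gamma> h by (intro \<alpha>.holomorphic_on_integral_powr) auto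
    ultimately show "(\<lambda>z. ?L z - exp (- ?R z)) holomorphic_on ?D"
      by (intro holomorphic_intros)
    show "open ?D"
      using open_vimage[OF open_greaterThanLessThan continuous_on_Re[OF continuous_on_id]] by (simp add: vimage_def)
    have "?D = {z. - \<epsilon> < Re z} \<inter> {z. Re z < \<epsilon>}" by auto
    then show "connected ?D"
      using convex_halfspace_Re_gt[of "- \<epsilon>"] convex_halfspace_Re_lt[of \<epsilon>] by (auto intro!: convex_connected convex_Int)
    show "(0::complex) islimpt of_real ` {- \<epsilon><..<\<epsilon>}"
      unfolding islimpt_approachable
    proof (intro allI impI)
      fix e :: real assume "e > 0"
      then show "\<exists>x'\<in>of_real ` {- \<epsilon><..<\<epsilon>}. x' \<noteq> (0::complex) \<and> dist x' 0 < e"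
        using \<epsilon> by (intro bexI[of _ "of_real (min \<epsilon> e / 2)"]) (auto simp: min_def simp del: of_real_divide)
    qed
    show "?L z - exp (- ?R z) = 0" if zU: "z \<in> of_real ` {- \<epsilon><..<\<epsilon>}" for z
    proof -
      obtain c where c: "z = of_real c" "c \<in> {- \<epsilon><..<\<epsilon>}" using zU by auto
      have "?L z = (CLINT s|S. of_real (?w s * exp (- (c * ?X s))))"
        by (simp add: c exp_of_real[symmetric])
      also have "\<dots> = of_real (\<integral>s. ?w s * exp (- (c * ?X s)) \<partial>S)"
        by (rule integral_complex_of_real)
      also have "\<dots> = exp (- of_real (\<integral>x. (u + \<epsilon> * \<bar>h x\<bar> + c * h x) powr \<gamma> \<partial>\<alpha>))"
        by (simp only: eq[OF c(2)] exp_of_real[symmetric] of_real_minus)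
      also have "of_real (\<integral>x. (u + \<epsilon> * \<bar>h x\<bar> + c * h x) powr \<gamma> \<partial>\<alpha>) = (CLINT x|\<alpha>. of_real ((u + \<epsilon> * \<bar>h x\<bar> + c * h x) powr \<gamma>))"
        by (rule integral_complex_of_real[symmetric])
      also have "\<dots> = ?R z"
        using nonneg[OF c(2)] by (intro Bochner_Integration.integral_cong) (simp_all add: c(1) powr_of_real[symmetric])
      finally show ?thesis by simp
    qed
  qed (use z \<epsilon> in auto)
  then show ?thesis by simp
qed

text \<open>The point \<open>- \<i>\<close> lies in the strip for every positive damping, so the
  damping can tend to 0 with the argument fixed. Dominated convergence handles both sides: the left
  integrand has modulus at most 1, the right one is bounded by a power of
  \<open>\<bar>h x\<bar>\<close>.\<close>

lemma CRM_joint_char: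
  fixes h :: "'a \<Rightarrow> real"
  assumes [measurable]: "h \<in> borel_measurable borel"
    and h: "integrable \<alpha> (\<lambda>x. \<bar>h x\<bar> powr \<gamma>)" and u: "0 < u"
  shows "(CLINT s|S. of_real (exp (- (u * measure (\<mu> s) UNIV))) * exp (\<i> * of_real (\<integral>x. h x \<partial>\<mu> s)))
    = exp (- (CLINT x|\<alpha>. (of_real u - \<i> * of_real (h x)) powr of_real \<gamma>))"
proof -
  define r where "r n = inverse (real (Suc n))" for n
  have r: "0 < r n" "r n \<le> 1" for n by (auto simp: r_def divide_simps)
  have r0: "r \<longlonglongrightarrow> 0" unfolding r_def[abs_def] by (rule LIMSEQ_inverse_real_of_nat)
  let ?L = "\<lambda>n. CLINT s|S. of_real (exp (- (u * measure (\<mu> s) UNIV + r n * (\<integral>x. \<bar>h x\<bar> \<partial>\<mu> s)))) * exp (\<i> * of_real (\<integral>x. h x \<partial>\<mu> s))"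
  let ?R = "\<lambda>n. CLINT x|\<alpha>. (of_real (u + r n * \<bar>h x\<bar>) + (- \<i>) * of_real (h x)) powr of_real \<gamma>"
  have eq: "?L n = exp (- ?R n)" for n
    using CRM_Laplace_strip[OF assms, of "- \<i>" "r n"] r by simp
  have "?L \<longlonglongrightarrow> (CLINT s|S. of_real (exp (- (u * measure (\<mu> s) UNIV + 0 * (\<integral>x. \<bar>h x\<bar> \<partial>\<mu> s)))) * exp (\<i> * of_real (\<integral>x. h x \<partial>\<mu> s)))"
  proof (rule integral_dominated_convergence[where w = "\<lambda>_. 1"])
    show "AE s in S. norm (of_real (exp (- (u * measure (\<mu> s) UNIV + r n * (\<integral>x. \<bar>h x\<bar> \<partial>\<mu> s)))) * exp (\<i> * of_real (\<integral>x. h x \<partial>\<mu> s))) \<le> 1" for n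
    proof (rule AE_I2)
      fix s
      have "0 \<le> u * measure (\<mu> s) UNIV + r n * (\<integral>x. \<bar>h x\<bar> \<partial>\<mu> s)"
        using u r[of n] by (intro add_nonneg_nonneg mult_nonneg_nonneg integral_nonneg) auto
      then show "norm (of_real (exp (- (u * measure (\<mu> s) UNIV + r n * (\<integral>x. \<bar>h x\<bar> \<partial>\<mu> s)))) * exp (\<i> * of_real (\<integral>x. h x \<partial>\<mu> s))) \<le> 1"
        by (simp add: norm_mult)
    qed
    show "AE s in S. (\<lambda>n. of_real (exp (- (u * measure (\<mu> s) UNIV + r n * (\<integral>x. \<bar>h x\<bar> \<partial>\<mu> s)))) * exp (\<i> * of_real (\<integral>x. h x \<partial>\<mu> s)))
      \<longlonglongrightarrow> of_real (exp (- (u * measure (\<mu> s) UNIV + 0 * (\<integral>x. \<bar>h x\<bar> \<partial>\<mu> s)))) * exp (\<i> * of_real (\<integral>x. h x \<partial>\<mu> s))"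
      by (intro AE_I2 tendsto_intros r0)
  qed auto
  moreover have "?R \<longlonglongrightarrow> (CLINT x|\<alpha>. (of_real (u + 0 * \<bar>h x\<bar>) + (- \<i>) * of_real (h x)) powr of_real \<gamma>)"
  proof (rule integral_dominated_convergence)
    \<comment> \<open>One \<open>\<bar>h x\<bar>\<close> bounds the damping, as
      \<open>r n \<le> 1\<close>, the other the imaginary part.\<close>
    show "integrable \<alpha> (\<lambda>x. (u + 2 * \<bar>h x\<bar>) powr \<gamma>)"
      using u \<gamma> h by (intro \<alpha>.integrable_powr_affine) auto
    show "AE x in \<alpha>. norm ((of_real (u + r n * \<bar>h x\<bar>) + (- \<i>) * of_real (h x)) powr (of_real \<gamma> :: complex)) \<le> (u + 2 * \<bar>h x\<bar>) powr \<gamma>" for n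
    proof (rule AE_I2)
      fix x
      let ?w = "of_real (u + r n * \<bar>h x\<bar>) + (- \<i>) * of_real (h x)"
      have "norm ?w \<le> norm (complex_of_real (u + r n * \<bar>h x\<bar>)) + norm ((- \<i>) * of_real (h x))"
        by (rule norm_triangle_ineq)
      also have "\<dots> = u + r n * \<bar>h x\<bar> + \<bar>h x\<bar>"
        using u r[of n] by (simp only: norm_of_real norm_mult) simp
      also have "\<dots> \<le> u + 2 * \<bar>h x\<bar>"
        using mult_right_mono[OF r(2)[of n], of "\<bar>h x\<bar>"] by simp
      finally have "norm ?w powr \<gamma> \<le> (u + 2 * \<bar>h x\<bar>) powr \<gamma>"
        using \<gamma> by (intro powr_mono2) auto
      then show "norm (?w powr (of_real \<gamma> :: complex)) \<le> (u + 2 * \<bar>h x\<bar>) powr \<gamma>"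
        by (cases "?w = 0") (auto simp: norm_powr_complex_of_real)
    qed
    show "AE x in \<alpha>. (\<lambda>n. (of_real (u + r n * \<bar>h x\<bar>) + (- \<i>) * of_real (h x)) powr (of_real \<gamma> :: complex))
      \<longlonglongrightarrow> (of_real (u + 0 * \<bar>h x\<bar>) + (- \<i>) * of_real (h x)) powr of_real \<gamma>"
      \<comment> \<open>The limit base has real part \<open>u > 0\<close>, so the complex power is
        continuous there.\<close>
      using u by (intro AE_I2 tendsto_powr_complex tendsto_intros r0) (auto simp: complex_nonpos_Reals_iff)
  qed measurable
  then have "?L \<longlonglongrightarrow> exp (- (CLINT x|\<alpha>. (of_real (u + 0 * \<bar>h x\<bar>) + (- \<i>) * of_real (h x)) powr of_real \<gamma>))"
    unfolding eq by (intro tendsto_intros)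
  ultimately show ?thesis
    using LIMSEQ_unique by fastforce
qed

end

section \<open>The tilted law\<close>

lemma measurable_measure_UNIV_bfm [measurable]: "(\<lambda>\<mu>. measure \<mu> UNIV) \<in> borel_measurable bfm_algebra"
  unfolding measure_def by measurable

lemma space_in_bfm_algebra: "\<mu> \<in> space bfm_algebra \<Longrightarrow> space \<mu> = UNIV"
  using sets_eq_imp_space_eq[OF sets_in_bfm_algebra] by simp

lemma measurable_mass_weight [measurable]: "mass_weight \<theta> \<in> borel_measurable bfm_algebra"
proof (subst measurable_cong)
  fix \<mu> :: "'a measure" assume "\<mu> \<in> space bfm_algebra"
  then show "mass_weight \<theta> \<mu> = (if emeasure \<mu> UNIV = \<infinity> then 0 else inverse (ennreal (measure \<mu> UNIV powr \<theta>)))"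
    by (simp add: mass_weight_def space_in_bfm_algebra)
qed measurable

text \<open>The total mass of the tilted law is the normalising integral divided by itself. In
  \<open>ennreal\<close> this quotient is 0 when the integral is 0 or infinite, so a total mass of 1
  rules out both.\<close>

lemma prob_space_tilted_law:
  assumes "prob_space (tilted_law \<theta> Q)" and Q: "sets Q = sets bfm_algebra"
  shows "(\<integral>\<^sup>+\<nu>. mass_weight \<theta> \<nu> \<partial>Q) \<noteq> 0" "(\<integral>\<^sup>+\<nu>. mass_weight \<theta> \<nu> \<partial>Q) \<noteq> \<infinity>"
proof -
  interpret prob_space "tilted_law \<theta> Q" by fact
  note Q[measurable_cong]
  have "1 = emeasure (tilted_law \<theta> Q) (space (tilted_law \<theta> Q))"
    by (simp add: emeasure_space_1)
  also have "\<dots> = (\<integral>\<^sup>+\<nu>. mass_weight \<theta> \<nu> / (\<integral>\<^sup>+\<nu>. mass_weight \<theta> \<nu> \<partial>Q) \<partial>Q)"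
    unfolding tilted_law_def by (subst emeasure_density) (auto intro!: nn_integral_cong)
  also have "\<dots> = (\<integral>\<^sup>+\<nu>. mass_weight \<theta> \<nu> \<partial>Q) / (\<integral>\<^sup>+\<nu>. mass_weight \<theta> \<nu> \<partial>Q)"
    by (rule nn_integral_divide) measurable
  finally show "(\<integral>\<^sup>+\<nu>. mass_weight \<theta> \<nu> \<partial>Q) \<noteq> 0" "(\<integral>\<^sup>+\<nu>. mass_weight \<theta> \<nu> \<partial>Q) \<noteq> \<infinity>"
    by (auto simp: divide_ennreal_def)
qed

lemma
  fixes g :: "'a::polish_space \<Rightarrow> real"
  assumes [measurable]: "g \<in> borel_measurable borel"
  shows mean_le_eq: "{m \<in> space bfm_algebra. (\<integral>x. g x \<partial>normalized m) \<le> \<sigma>} = {m \<in> space bfm_algebra. (\<integral>x. g x \<partial>m) / measure m UNIV \<le> \<sigma>}"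
    and sets_mean_le: "{m \<in> space bfm_algebra. (\<integral>x. g x \<partial>normalized m) \<le> \<sigma>} \<in> sets bfm_algebra"
proof -
  show T: "{m \<in> space bfm_algebra. (\<integral>x. g x \<partial>normalized m) \<le> \<sigma>} = {m \<in> space bfm_algebra. (\<integral>x. g x \<partial>m) / measure m UNIV \<le> \<sigma>}"
  proof (intro Collect_cong conj_cong refl)
    fix m :: "'a measure" assume m: "m \<in> space bfm_algebra"
    have "g \<in> borel_measurable m" using sets_in_bfm_algebra[OF m] by (simp cong: measurable_cong_sets)
    then show "((\<integral>x. g x \<partial>normalized m) \<le> \<sigma>) = ((\<integral>x. g x \<partial>m) / measure m UNIV \<le> \<sigma>)"
      by (simp add: integral_normalized space_in_bfm_algebra[OF m])
  qed
  show "{m \<in> space bfm_algebra. (\<integral>x. g x \<partial>normalized m) \<le> \<sigma>} \<in> sets bfm_algebra"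
    unfolding T by measurable
qed

locale tilted_stable_CRM = finite_stable_CRM S \<alpha> \<gamma> \<mu>
  for S :: "'s measure" and \<alpha> :: "'a::polish_space measure" and \<gamma> :: real and \<mu> :: "'s \<Rightarrow> 'a measure" +
  fixes \<theta> :: real
  assumes \<theta>: "0 < \<theta>" and \<alpha>_pos: "0 < emeasure \<alpha> UNIV"
    and tilted: "prob_space (tilted_law \<theta> (distr S bfm_algebra \<mu>))"
begin

definition tilt_const :: real where "tilt_const = enn2real (\<integral>\<^sup>+\<nu>. mass_weight \<theta> \<nu> \<partial>distr S bfm_algebra \<mu>)"

lemma tilt_const: "ennreal tilt_const = (\<integral>\<^sup>+\<nu>. mass_weight \<theta> \<nu> \<partial>distr S bfm_algebra \<mu>)" "0 < tilt_const"
  using prob_space_tilted_law[OF tilted] unfolding tilt_const_def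
  by (auto simp: less_top enn2real_positive_iff zero_less_iff_neq_zero)

lemma AE_mass_weight: "AE s in S. mass_weight \<theta> (\<mu> s) = ennreal (measure (\<mu> s) UNIV powr (- \<theta>))"
  using AE_CRM_mass_finite AE_CRM_mass_pos[OF \<alpha>_pos] AE_space
proof eventually_elim
  case (elim s)
  then show ?case
    by (simp add: mass_weight_def space_CRM inverse_ennreal powr_minus)
qed

lemma tilt_const_eq: "ennreal tilt_const = (\<integral>\<^sup>+s. ennreal (measure (\<mu> s) UNIV powr (- \<theta>)) \<partial>S)"
proof -
  have "ennreal tilt_const = (\<integral>\<^sup>+s. mass_weight \<theta> (\<mu> s) \<partial>S)"
    unfolding tilt_const by (rule nn_integral_distr) measurable
  then show ?thesis using AE_mass_weight by (simp cong: nn_integral_cong_AE)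
qed

text \<open>Moves the probability back to \<open>S\<close>. The mass is almost surely positive and
  finite, so the normalised mean is at most \<open>\<sigma>\<close> exactly when the integral of
  \<open>g - \<sigma>\<close> is at most 0.\<close>

lemma emeasure_tilted_law_mean_le:
  fixes g :: "'a \<Rightarrow> real"
  assumes [measurable]: "g \<in> borel_measurable borel" and g: "integrable \<alpha> (\<lambda>x. \<bar>g x - \<sigma>\<bar> powr \<gamma>)"
  shows "emeasure (tilted_law \<theta> (distr S bfm_algebra \<mu>)) {m \<in> space bfm_algebra. (\<integral>x. g x \<partial>normalized m) \<le> \<sigma>}
    = (\<integral>\<^sup>+s. ennreal (measure (\<mu> s) UNIV powr (- \<theta>) / tilt_const) * indicator {s\<in>space S. (\<integral>x. g x - \<sigma> \<partial>\<mu> s) \<le> 0} s \<partial>S)"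
proof -
  let ?T = "{m \<in> space bfm_algebra. (\<integral>x. g x \<partial>normalized m) \<le> \<sigma>}"
  note [measurable] = sets_mean_le[OF assms(1)]
  have "emeasure (tilted_law \<theta> (distr S bfm_algebra \<mu>)) ?T
     = (\<integral>\<^sup>+m. mass_weight \<theta> m / ennreal tilt_const * indicator ?T m \<partial>distr S bfm_algebra \<mu>)"
    unfolding tilted_law_def tilt_const(1)[symmetric] by (rule emeasure_density) auto
  also have "\<dots> = (\<integral>\<^sup>+s. mass_weight \<theta> (\<mu> s) / ennreal tilt_const * indicator ?T (\<mu> s) \<partial>S)"
    by (rule nn_integral_distr) auto
  also have "\<dots> = (\<integral>\<^sup>+s. ennreal (measure (\<mu> s) UNIV powr (- \<theta>) / tilt_const) * indicator {s\<in>space S. (\<integral>x. g x - \<sigma> \<partial>\<mu> s) \<le> 0} s \<partial>S)"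
  proof (rule nn_integral_cong_AE)
    have "AE s in S. integrable (\<mu> s) (\<lambda>x. g x - \<sigma>)"
      by (rule AE_CRM_integrable) (use g in auto)
    then show "AE s in S. mass_weight \<theta> (\<mu> s) / ennreal tilt_const * indicator ?T (\<mu> s)
      = ennreal (measure (\<mu> s) UNIV powr (- \<theta>) / tilt_const) * indicator {s\<in>space S. (\<integral>x. g x - \<sigma> \<partial>\<mu> s) \<le> 0} s"
      using AE_mass_weight AE_CRM_mass_finite AE_CRM_mass_pos[OF \<alpha>_pos] AE_space
    proof eventually_elim
      case (elim s)
      interpret m: finite_measure "\<mu> s"
        using elim by (intro finite_measureI) (auto simp: space_CRM)
      have "integrable (\<mu> s) (\<lambda>x. (g x - \<sigma>) + \<sigma>)" using elim(1) by (intro Bochner_Integration.integrable_add) auto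
      then have "integrable (\<mu> s) g" by simp
      then have "(\<integral>x. g x - \<sigma> \<partial>\<mu> s) = (\<integral>x. g x \<partial>\<mu> s) - \<sigma> * measure (\<mu> s) UNIV"
        by (simp add: Bochner_Integration.integral_diff space_CRM[OF elim(5)] mult.commute)
      then have "(\<integral>x. g x \<partial>\<mu> s) / measure (\<mu> s) UNIV \<le> \<sigma> \<longleftrightarrow> (\<integral>x. g x - \<sigma> \<partial>\<mu> s) \<le> 0"
        using elim(4) by (simp add: divide_le_eq)
      then have "indicator ?T (\<mu> s) = (indicator {s\<in>space S. (\<integral>x. g x - \<sigma> \<partial>\<mu> s) \<le> 0} s :: ennreal)"
        unfolding mean_le_eq[OF assms(1)] using measurable_space[OF measurable_CRM elim(5)] elim(5) by (simp add: indicator_def)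
      then show ?case using elim(2) tilt_const(2) by (simp add: divide_ennreal)
    qed
  qed
  finally show ?thesis .
qed

text \<open>Tonelli read in both orders: integrating over \<open>s\<close> first gives the Laplace
  transform of the mass, integrating over \<open>u\<close> first gives a Gamma integral. The scale
  \<open>c\<close> is kept free so that it can later absorb the mass of
  \<open>\<alpha>\<close>.\<close>

lemma nn_integral_mass_powr_exp:
  assumes "0 < c"
  shows "(\<integral>\<^sup>+u\<in>{0<..}. ennreal (u powr (\<theta> - 1) * exp (- ((c * u) powr \<gamma> * measure \<alpha> UNIV))) \<partial>lborel) = ennreal (Gamma \<theta> * c powr (- \<theta>) * tilt_const)"
proof -
  have "(\<integral>\<^sup>+u\<in>{0<..}. ennreal (u powr (\<theta> - 1) * exp (- ((c * u) powr \<gamma> * measure \<alpha> UNIV))) \<partial>lborel)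
     = (\<integral>\<^sup>+u. (\<integral>\<^sup>+s. ennreal (u powr (\<theta> - 1) * exp (- (u * (c * measure (\<mu> s) UNIV)))) * indicator {0<..} u \<partial>S) \<partial>lborel)"
  proof (rule nn_integral_cong)
    fix u :: real
    show "ennreal (u powr (\<theta> - 1) * exp (- ((c * u) powr \<gamma> * measure \<alpha> UNIV))) * indicator {0<..} u
       = (\<integral>\<^sup>+s. ennreal (u powr (\<theta> - 1) * exp (- (u * (c * measure (\<mu> s) UNIV)))) * indicator {0<..} u \<partial>S)"
    proof (cases "u > 0")
      case True
      have "integrable S (\<lambda>s. exp (- (c * u * measure (\<mu> s) UNIV)))"
        using True assms by (intro integrable_const_bound[where B = 1]) auto
      then have "(\<integral>\<^sup>+s. ennreal (exp (- (c * u * measure (\<mu> s) UNIV))) \<partial>S) = ennreal (exp (- ((c * u) powr \<gamma> * measure \<alpha> UNIV)))"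
        using True assms CRM_mass_Laplace[of "c * u"] by (subst nn_integral_eq_integral) auto
      then show ?thesis using True
        by (simp add: ennreal_mult' nn_integral_cmult ac_simps)
    qed auto
  qed
  also have "\<dots> = (\<integral>\<^sup>+s. (\<integral>\<^sup>+u. ennreal (u powr (\<theta> - 1) * exp (- (u * (c * measure (\<mu> s) UNIV)))) * indicator {0<..} u \<partial>lborel) \<partial>S)"
  proof -
    interpret P: pair_sigma_finite S lborel ..
    show ?thesis by (rule P.Fubini') measurable
  qed
  also have "\<dots> = (\<integral>\<^sup>+s. ennreal (Gamma \<theta> * c powr (- \<theta>)) * ennreal (measure (\<mu> s) UNIV powr (- \<theta>)) \<partial>S)"
  proof (rule nn_integral_cong_AE)
    show "AE s in S. (\<integral>\<^sup>+u. ennreal (u powr (\<theta> - 1) * exp (- (u * (c * measure (\<mu> s) UNIV)))) * indicator {0<..} u \<partial>lborel)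
      = ennreal (Gamma \<theta> * c powr (- \<theta>)) * ennreal (measure (\<mu> s) UNIV powr (- \<theta>))"
      using AE_CRM_mass_pos[OF \<alpha>_pos]
    proof eventually_elim
      case (elim s)
      then show ?case using assms nn_integral_powr_exp[OF \<theta>, of "c * measure (\<mu> s) UNIV"]
        by (simp add: powr_mult ennreal_mult''[symmetric] mult.assoc)
    qed
  qed
  also have "\<dots> = ennreal (Gamma \<theta> * c powr (- \<theta>)) * ennreal tilt_const"
    unfolding tilt_const_eq by (rule nn_integral_cmult) measurable
  also have "\<dots> = ennreal (Gamma \<theta> * c powr (- \<theta>) * tilt_const)"
    using tilt_const(2) by (simp add: ennreal_mult'')
  finally show ?thesis .
qed

text \<open>No estimate at infinity is needed: the integral is finite because the tilted law has total mass one.\<close>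

lemma set_integrable_stretched_exp:
  "set_integrable lborel {0<..} (\<lambda>u. u powr (\<theta> - 1) * exp (- (u powr \<gamma>)))"
proof -
  have a: "0 < measure \<alpha> UNIV" using \<alpha>_pos by (simp add: \<alpha>.emeasure_eq_measure)
  define c where "c = measure \<alpha> UNIV powr (- 1 / \<gamma>)"
  have c: "c > 0" using a by (simp add: c_def)
  have "c powr \<gamma> = measure \<alpha> UNIV powr (- 1)" unfolding c_def powr_powr using \<gamma> by simp
  then have cg: "c powr \<gamma> * measure \<alpha> UNIV = 1" using a by (simp add: powr_minus)
  have "(\<integral>\<^sup>+u. ennreal (indicator {0<..} u *\<^sub>R (u powr (\<theta> - 1) * exp (- (u powr \<gamma>)))) \<partial>lborel)
     = (\<integral>\<^sup>+u\<in>{0<..}. ennreal (u powr (\<theta> - 1) * exp (- ((c * u) powr \<gamma> * measure \<alpha> UNIV))) \<partial>lborel)"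
  proof (rule nn_integral_cong)
    fix u :: real
    have "(c * u) powr \<gamma> * measure \<alpha> UNIV = u powr \<gamma>" if "u > 0"
      using that c cg by (simp add: powr_mult)
    then show "ennreal (indicator {0<..} u *\<^sub>R (u powr (\<theta> - 1) * exp (- (u powr \<gamma>))))
      = ennreal (u powr (\<theta> - 1) * exp (- ((c * u) powr \<gamma> * measure \<alpha> UNIV))) * indicator {0<..} u"
      by (auto simp: indicator_def)
  qed
  then show ?thesis
    unfolding set_integrable_def nn_integral_mass_powr_exp[OF c]
    by (intro integrableI_nonneg) (auto simp: less_top[symmetric])
qed

text \<open>Conditionally on \<open>s\<close>, the coordinate \<open>u\<close> is a gamma variable
  with shape \<open>\<theta>\<close> and rate the total mass of \<open>\<mu> s\<close>. The divisor
  is the integral of the unnormalised density.\<close>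

definition joint_law :: "('s \<times> real) measure" where
  "joint_law = density (S \<Otimes>\<^sub>M lborel) (\<lambda>(s, u). ennreal
     (indicator {0<..} u * u powr (\<theta> - 1) * exp (- (u * measure (\<mu> s) UNIV)) / (Gamma \<theta> * tilt_const)))"

lemma Gamma_tilt_const_pos: "0 < Gamma \<theta> * tilt_const"
  using \<theta> tilt_const(2) Gamma_real_pos[of \<theta>] by simp

text \<open>Integrating out \<open>u\<close> produces \<open>Gamma \<theta>\<close> times the
  tilting weight. The identity is stated for the density under the product measure because it yields
  both the marginal of \<open>joint_law\<close> and the integrability needed for Fubini.\<close>

lemma joint_law_cylinder:
  assumes [measurable]: "B \<in> sets S"
  shows "(\<integral>\<^sup>+p. ennreal (case p of (s, u) \<Rightarrow> indicator {0<..} u * u powr (\<theta> - 1) * exp (- (u * measure (\<mu> s) UNIV)) / (Gamma \<theta> * tilt_const))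
      * indicator B (fst p) \<partial>(S \<Otimes>\<^sub>M lborel))
    = (\<integral>\<^sup>+s. ennreal (measure (\<mu> s) UNIV powr (- \<theta>) / tilt_const) * indicator B s \<partial>S)" (is "?L = ?R")
proof -
  have "?L = (\<integral>\<^sup>+s. (\<integral>\<^sup>+u. ennreal (indicator {0<..} u * u powr (\<theta> - 1) * exp (- (u * measure (\<mu> s) UNIV)) / (Gamma \<theta> * tilt_const)) * indicator B s \<partial>lborel) \<partial>S)"
    by (subst lborel.nn_integral_fst[symmetric]) (auto simp: split_beta')
  also have "\<dots> = ?R"
  proof (rule nn_integral_cong_AE)
    show "AE s in S. (\<integral>\<^sup>+u. ennreal (indicator {0<..} u * u powr (\<theta> - 1) * exp (- (u * measure (\<mu> s) UNIV)) / (Gamma \<theta> * tilt_const)) * indicator B s \<partial>lborel)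
      = ennreal (measure (\<mu> s) UNIV powr (- \<theta>) / tilt_const) * indicator B s"
      using AE_CRM_mass_pos[OF \<alpha>_pos]
    proof eventually_elim
      case (elim s)
      have "(\<integral>\<^sup>+u. ennreal (indicator {0<..} u * u powr (\<theta> - 1) * exp (- (u * measure (\<mu> s) UNIV)) / (Gamma \<theta> * tilt_const)) * indicator B s \<partial>lborel)
        = (\<integral>\<^sup>+u. (ennreal (1 / (Gamma \<theta> * tilt_const)) * indicator B s) * (ennreal (u powr (\<theta> - 1) * exp (- (u * measure (\<mu> s) UNIV))) * indicator {0<..} u) \<partial>lborel)"
        using Gamma_tilt_const_pos
        by (intro nn_integral_cong) (auto simp: indicator_def ennreal_mult''[symmetric])
      also have "\<dots> = (ennreal (1 / (Gamma \<theta> * tilt_const)) * indicator B s) * ennreal (Gamma \<theta> * measure (\<mu> s) UNIV powr - \<theta>)"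
        using elim by (subst nn_integral_cmult) (auto simp: nn_integral_powr_exp[OF \<theta>])
      also have "\<dots> = ennreal (measure (\<mu> s) UNIV powr (- \<theta>) / tilt_const) * indicator B s"
        using Gamma_real_pos[OF \<theta>] tilt_const(2)
        by (auto simp: indicator_def ennreal_mult''[symmetric])
      finally show ?case .
    qed
  qed
  finally show ?thesis .
qed

lemma sets_joint_law [measurable_cong]: "sets joint_law = sets (S \<Otimes>\<^sub>M lborel)"
  by (simp add: joint_law_def)

lemma space_joint_law: "space joint_law = space S \<times> UNIV"
  by (simp add: joint_law_def space_pair_measure)

lemma emeasure_joint_law_cylinder:
  assumes B: "B \<in> sets S"
  shows "emeasure joint_law (B \<times> UNIV) = (\<integral>\<^sup>+s. ennreal (measure (\<mu> s) UNIV powr (- \<theta>) / tilt_const) * indicator B s \<partial>S)"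
proof -
  note [measurable] = B
  have "B \<times> UNIV \<in> sets (S \<Otimes>\<^sub>M lborel)" by measurable
  then show ?thesis
    unfolding joint_law_cylinder[OF B, symmetric] joint_law_def
    by (subst emeasure_density) (auto intro!: nn_integral_cong simp: indicator_def)
qed

lemma prob_space_joint_law: "prob_space joint_law"
proof
  have "emeasure joint_law (space joint_law) = (\<integral>\<^sup>+s. ennreal (1 / tilt_const) * ennreal (measure (\<mu> s) UNIV powr (- \<theta>)) \<partial>S)"
    unfolding space_joint_law using tilt_const(2)
    by (subst emeasure_joint_law_cylinder) (auto intro!: nn_integral_cong simp: ennreal_mult''[symmetric])
  also have "\<dots> = ennreal (1 / tilt_const) * ennreal tilt_const"
    unfolding tilt_const_eq by (rule nn_integral_cmult) measurable
  also have "\<dots> = 1" using tilt_const(2) by (simp add: ennreal_mult''[symmetric])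
  finally show "emeasure joint_law (space joint_law) = 1" .
qed

lemma integrable_joint_density:
  "integrable (S \<Otimes>\<^sub>M lborel) (\<lambda>(s, u). indicator {0<..} u * u powr (\<theta> - 1) * exp (- (u * measure (\<mu> s) UNIV)) / (Gamma \<theta> * tilt_const))"
proof (rule integrableI_nonneg)
  interpret N: prob_space joint_law by (rule prob_space_joint_law)
  have "1 = emeasure joint_law (space S \<times> UNIV)"
    using N.emeasure_space_1 by (simp add: space_joint_law)
  also have "\<dots> = (\<integral>\<^sup>+p. ennreal (case p of (s, u) \<Rightarrow> indicator {0<..} u * u powr (\<theta> - 1) * exp (- (u * measure (\<mu> s) UNIV)) / (Gamma \<theta> * tilt_const)) \<partial>(S \<Otimes>\<^sub>M lborel))"
    unfolding emeasure_joint_law_cylinder[OF sets.top] joint_law_cylinder[OF sets.top, symmetric]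
    by (intro nn_integral_cong) (auto simp: space_pair_measure)
  finally show "(\<integral>\<^sup>+p. ennreal (case p of (s, u) \<Rightarrow> indicator {0<..} u * u powr (\<theta> - 1) * exp (- (u * measure (\<mu> s) UNIV)) / (Gamma \<theta> * tilt_const)) \<partial>(S \<Otimes>\<^sub>M lborel)) < \<infinity>"
    by simp
qed (use Gamma_tilt_const_pos in \<open>auto simp: split_beta'\<close>)

context
  fixes h :: "'a \<Rightarrow> real"
  assumes h_meas [measurable]: "h \<in> borel_measurable borel"
    and h: "integrable \<alpha> (\<lambda>x. \<bar>h x\<bar> powr \<gamma>)"
begin

definition Z_law :: "real measure" where
  "Z_law = distr joint_law borel (\<lambda>(s, u). u * (\<integral>x. h x \<partial>\<mu> s))"

lemma measurable_Z [measurable]: "(\<lambda>(s, u). u * (\<integral>x. h x \<partial>\<mu> s)) \<in> borel_measurable joint_law"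
  by (simp add: split_beta')

lemma real_distribution_Z_law: "real_distribution Z_law"
  unfolding Z_law_def
  by (intro prob_space.real_distribution_distr prob_space_joint_law measurable_Z)

text \<open>The density vanishes for \<open>u \<le> 0\<close>, so almost surely the factor
  \<open>u\<close> is positive and preserves the sign of the integral. For
  \<open>h = g - \<sigma>\<close> the right-hand side is that of
  \<open>emeasure_tilted_law_mean_le\<close>.\<close>

lemma emeasure_Z_law:
  "emeasure Z_law {..0} = (\<integral>\<^sup>+s. ennreal (measure (\<mu> s) UNIV powr (- \<theta>) / tilt_const) * indicator {s\<in>space S. (\<integral>x. h x \<partial>\<mu> s) \<le> 0} s \<partial>S)"
proof -
  have "emeasure Z_law {..0} = emeasure joint_law ((\<lambda>(s, u). u * (\<integral>x. h x \<partial>\<mu> s)) -` {..0} \<inter> space joint_law)"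
    unfolding Z_law_def by (rule emeasure_distr) auto
  also have "\<dots> = emeasure joint_law ({s\<in>space S. (\<integral>x. h x \<partial>\<mu> s) \<le> 0} \<times> UNIV)"
  proof (rule emeasure_eq_AE)
    show "AE p in joint_law. (p \<in> (\<lambda>(s, u). u * (\<integral>x. h x \<partial>\<mu> s)) -` {..0} \<inter> space joint_law)
      = (p \<in> {s\<in>space S. (\<integral>x. h x \<partial>\<mu> s) \<le> 0} \<times> UNIV)"
      unfolding joint_law_def
      by (subst AE_density) (auto intro!: AE_I2 simp: space_pair_measure indicator_def mult_le_0_iff split: if_splits)
  qed measurable
  also have "\<dots> = (\<integral>\<^sup>+s. ennreal (measure (\<mu> s) UNIV powr (- \<theta>) / tilt_const) * indicator {s\<in>space S. (\<integral>x. h x \<partial>\<mu> s) \<le> 0} s \<partial>S)"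
    by (rule emeasure_joint_law_cylinder) measurable
  finally show ?thesis .
qed

text \<open>For fixed \<open>u\<close> the integral over \<open>s\<close> is
  \<open>CRM_joint_char\<close> applied to \<open>u * t * h\<close>. Homogeneity of the power
  extracts \<open>u powr \<gamma>\<close> from the exponent, and what remains is a stretched
  exponential integral with a complex rate.\<close>

lemma char_Z_law_aux:
  "char Z_law t = (CLINT x|\<alpha>. (1 - \<i> * of_real (t * h x)) powr of_real \<gamma>) powr of_real (- \<theta> / \<gamma>)
     * of_real ((LBINT u:{0<..}. u powr (\<theta> - 1) * exp (- (u powr \<gamma>))) / (Gamma \<theta> * tilt_const))"
  if ReK: "0 < Re (CLINT x|\<alpha>. (1 - \<i> * of_real (t * h x)) powr of_real \<gamma>)"
proof -
  interpret P: pair_sigma_finite S lborel ..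
  let ?w = "\<lambda>s u. indicator {0<..} u * u powr (\<theta> - 1) * exp (- (u * measure (\<mu> s) UNIV)) / (Gamma \<theta> * tilt_const)"
  let ?X = "\<lambda>s. \<integral>x. h x \<partial>\<mu> s"
  let ?K = "CLINT x|\<alpha>. (1 - \<i> * of_real (t * h x)) powr of_real \<gamma>"
  have "char Z_law t = (CLINT p|joint_law. iexp (t * (case p of (s, u) \<Rightarrow> u * ?X s)))"
    unfolding char_def Z_law_def by (rule integral_distr) auto
  also have "\<dots> = (CLINT p|S \<Otimes>\<^sub>M lborel. (case p of (s, u) \<Rightarrow> ?w s u) *\<^sub>R iexp (t * (case p of (s, u) \<Rightarrow> u * ?X s)))"
    unfolding joint_law_def using Gamma_tilt_const_pos
    by (subst integral_density[symmetric]) (auto simp: split_beta')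
  also have "\<dots> = (CLINT p|S \<Otimes>\<^sub>M lborel. (case p of (s, u) \<Rightarrow> of_real (?w s u) * iexp (t * (u * ?X s))))"
    by (simp add: split_beta' scaleR_conv_of_real)
  also have "\<dots> = (CLBINT u. (CLINT s|S. of_real (?w s u) * iexp (t * (u * ?X s))))"
  proof (rule P.integral_snd[symmetric])
    show "complex_integrable (S \<Otimes>\<^sub>M lborel) (\<lambda>(s, u). of_real (?w s u) * iexp (t * (u * ?X s)))"
      using Gamma_tilt_const_pos
      by (intro Bochner_Integration.integrable_bound[OF integrable_joint_density])
         (auto intro!: AE_I2 simp: split_beta' norm_mult norm_divide abs_mult simp del: of_real_mult)
  qed
  also have "\<dots> = (CLBINT u. of_real (1 / (Gamma \<theta> * tilt_const)) * (of_real (indicator {0<..} u * u powr (\<theta> - 1)) * exp (- (?K * of_real (u powr \<gamma>)))))"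
  proof (rule Bochner_Integration.integral_cong[OF refl])
    fix u :: real
    show "(CLINT s|S. of_real (?w s u) * iexp (t * (u * ?X s)))
      = of_real (1 / (Gamma \<theta> * tilt_const)) * (of_real (indicator {0<..} u * u powr (\<theta> - 1)) * exp (- (?K * of_real (u powr \<gamma>))))"
    proof (cases "u > 0")
      case True
      have "(CLINT s|S. of_real (?w s u) * iexp (t * (u * ?X s)))
        = (CLINT s|S. of_real (u powr (\<theta> - 1) / (Gamma \<theta> * tilt_const)) * (of_real (exp (- (u * measure (\<mu> s) UNIV))) * exp (\<i> * of_real (\<integral>x. (u * t) * h x \<partial>\<mu> s))))"
        using True by (intro Bochner_Integration.integral_cong) (simp_all add: mult_ac)
      also have "\<dots> = of_real (u powr (\<theta> - 1) / (Gamma \<theta> * tilt_const)) * (CLINT s|S. of_real (exp (- (u * measure (\<mu> s) UNIV))) * exp (\<i> * of_real (\<integral>x. (u * t) * h x \<partial>\<mu> s)))"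
        by (rule integral_mult_right_zero)
      also have "(CLINT s|S. of_real (exp (- (u * measure (\<mu> s) UNIV))) * exp (\<i> * of_real (\<integral>x. (u * t) * h x \<partial>\<mu> s)))
         = exp (- (CLINT x|\<alpha>. (of_real u - \<i> * of_real ((u * t) * h x)) powr of_real \<gamma>))"
      proof (rule CRM_joint_char[OF _ _ True])
        show "integrable \<alpha> (\<lambda>x. \<bar>u * t * h x\<bar> powr \<gamma>)"
          using h by (simp add: abs_mult powr_mult)
      qed measurable
      also have "(CLINT x|\<alpha>. (of_real u - \<i> * of_real ((u * t) * h x)) powr of_real \<gamma>)
         = (CLINT x|\<alpha>. of_real (u powr \<gamma>) * (1 - \<i> * of_real (t * h x)) powr of_real \<gamma>)"
      proof (rule Bochner_Integration.integral_cong[OF refl])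
        fix x
        have "1 - \<i> * of_real (t * h x) \<noteq> 0" by (auto simp: complex_eq_iff)
        from powr_of_real_mult[OF True this, of "of_real \<gamma>"]
        have "(of_real u * (1 - \<i> * of_real (t * h x))) powr of_real \<gamma>
          = of_real (u powr \<gamma>) * (1 - \<i> * of_real (t * h x)) powr of_real \<gamma>"
          using True by (simp only: powr_of_real less_imp_le)
        moreover have "of_real u - \<i> * of_real ((u * t) * h x) = of_real u * (1 - \<i> * of_real (t * h x))"
          by (simp add: algebra_simps)
        ultimately show "(of_real u - \<i> * of_real ((u * t) * h x)) powr of_real \<gamma>
          = of_real (u powr \<gamma>) * (1 - \<i> * of_real (t * h x)) powr of_real \<gamma>"
          by (simp only:)
      qed
      also have "\<dots> = of_real (u powr \<gamma>) * ?K"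
        by (rule integral_mult_right_zero)
      finally show ?thesis using True by (simp add: mult_ac)
    qed simp
  qed
  also have "\<dots> = of_real (1 / (Gamma \<theta> * tilt_const)) * (CLBINT u. of_real (indicator {0<..} u * u powr (\<theta> - 1)) * exp (- (?K * of_real (u powr \<gamma>))))"
    by (rule integral_mult_right_zero)
  also have "(CLBINT u. of_real (indicator {0<..} u * u powr (\<theta> - 1)) * exp (- (?K * of_real (u powr \<gamma>))))
    = ?K powr of_real (- \<theta> / \<gamma>) * of_real (LBINT u:{0<..}. u powr (\<theta> - 1) * exp (- (u powr \<gamma>)))"
    by (rule integral_stretched_exp[OF ReK \<gamma>(1) set_integrable_stretched_exp])
  finally show ?thesis by simp
qed

text \<open>The constant is fixed by comparing with the value 1 at \<open>t = 0\<close>, where the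
  complex integral is just the mass of \<open>\<alpha>\<close>; neither \<open>tilt_const\<close>
  nor the stretched exponential integral has to be evaluated.\<close>

lemma char_Z_law:
  assumes ReK: "0 < Re (CLINT x|\<alpha>. (1 - \<i> * of_real (t * h x)) powr of_real \<gamma>)"
  shows "char Z_law t = of_real (measure \<alpha> UNIV powr (\<theta> / \<gamma>)) *
     (CLINT x|\<alpha>. (1 - \<i> * of_real (t * h x)) powr of_real \<gamma>) powr of_real (- \<theta> / \<gamma>)"
proof -
  define q where "q = (LBINT u:{0<..}. u powr (\<theta> - 1) * exp (- (u powr \<gamma>))) / (Gamma \<theta> * tilt_const)"
  have a: "0 < measure \<alpha> UNIV" using \<alpha>_pos by (simp add: \<alpha>.emeasure_eq_measure)
  have K0: "(CLINT x|\<alpha>. (1 - \<i> * of_real (0 * h x)) powr of_real \<gamma>) = of_real (measure \<alpha> UNIV)"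
    using sets_eq_imp_space_eq[OF sets_\<alpha>] by (simp add: scaleR_conv_of_real)
  interpret Z: real_distribution Z_law by (rule real_distribution_Z_law)
  have "1 = complex_of_real (measure \<alpha> UNIV) powr of_real (- \<theta> / \<gamma>) * of_real q"
    using char_Z_law_aux[of 0, unfolded K0] a Z.char_zero by (simp add: q_def)
  also have "complex_of_real (measure \<alpha> UNIV) powr of_real (- \<theta> / \<gamma>) = of_real (measure \<alpha> UNIV powr (- \<theta> / \<gamma>))"
    using a by (intro powr_of_real) auto
  finally have "1 = measure \<alpha> UNIV powr (- \<theta> / \<gamma>) * q"
    by (metis of_real_1 of_real_eq_iff of_real_mult)
  then have "q = measure \<alpha> UNIV powr (\<theta> / \<gamma>)"
    using a by (simp add: powr_minus field_simps)
  then show ?thesis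
    using char_Z_law_aux[OF ReK] by (simp add: q_def mult.commute)
qed

end

end

section \<open>Gil-Pelaez inversion at the origin\<close>

lemma (in finite_measure) set_integral_swap_bounded:
  fixes f :: "'a \<Rightarrow> real \<Rightarrow> real"
  assumes f [measurable]: "(\<lambda>(x, t). f x t) \<in> borel_measurable (M \<Otimes>\<^sub>M lborel)"
    and A [measurable]: "A \<in> sets borel" and fin: "emeasure lborel A < \<infinity>"
    and B: "\<And>x t. t \<in> A \<Longrightarrow> \<bar>f x t\<bar> \<le> B"
  shows "(LBINT t:A. (\<integral>x. f x t \<partial>M)) = (\<integral>x. (LBINT t:A. f x t) \<partial>M)"
proof -
  interpret pair_sigma_finite M lborel ..
  have "integrable (M \<Otimes>\<^sub>M lborel) (\<lambda>(x, t). indicator A t * f x t)"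
  proof (rule integrableI_bounded_set[where A = "space M \<times> A" and B = "\<bar>B\<bar>"])
    show "emeasure (M \<Otimes>\<^sub>M lborel) (space M \<times> A) < \<infinity>"
      using fin by (subst lborel.emeasure_pair_measure_Times) (auto simp: ennreal_mult_less_top emeasure_eq_measure)
    show "AE x in M \<Otimes>\<^sub>M lborel. x \<in> space M \<times> A \<longrightarrow> norm (case x of (x, t) \<Rightarrow> indicator A t * f x t) \<le> \<bar>B\<bar>"
      by (intro AE_I2) (auto simp: indicator_def intro: order_trans[OF B abs_ge_self])
  qed (auto intro!: AE_I2 simp: space_pair_measure indicator_def split: if_splits)
  from Fubini_integral[OF this] show ?thesis
    by (simp add: set_lebesgue_integral_def)
qed

text \<open>\<open>Si\<close> integrates from 0, so the lower cutoff appears as a difference;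
  \<open>sgn x\<close> carries the sign, which leaves \<open>Si\<close> at nonnegative
  arguments.\<close>

lemma set_integral_sin_div:
  fixes s T x :: real
  assumes "0 < s" "s \<le> T"
  shows "(LBINT t:{s..T}. sin (t * x) / t) = sgn x * (Si (T * \<bar>x\<bar>) - Si (s * \<bar>x\<bar>))"
proof -
  have "(LBINT t=0..s. sin (t * x) / t) + (LBINT t=s..T. sin (t * x) / t) = (LBINT t=0..T. sin (t * x) / t)"
    using assms integrable_sinc'[of T x] by (intro interval_integral_sum) (auto simp: zero_ereal_def min_def max_def)
  then show ?thesis
    using assms LBINT_I0c_sin_scale_divide[of T x] LBINT_I0c_sin_scale_divide[of s x]
    by (simp add: interval_integral_Icc right_diff_distrib zero_ereal_def)
qed

context real_distribution
begin

lemma Re_char: "Re (char M t) = (\<integral>x. cos (t * x) \<partial>M)"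
proof -
  have "complex_integrable M (\<lambda>x. cis (t * x))"
    by (rule integrable_const_bound[where B = 1]) (auto simp: cis_conv_exp)
  from integral_Re[OF this] show ?thesis
    by (simp add: char_def cis_conv_exp[symmetric] del: of_real_mult)
qed

lemma Im_char: "Im (char M t) = (\<integral>x. sin (t * x) \<partial>M)"
proof -
  have "complex_integrable M (\<lambda>x. cis (t * x))"
    by (rule integrable_const_bound[where B = 1]) (auto simp: cis_conv_exp)
  from integral_Im[OF this] show ?thesis
    by (simp add: char_def cis_conv_exp[symmetric] del: of_real_mult)
qed

text \<open>An atom at 0 is the limit of averages of the characteristic function over
  \<open>[0, n]\<close>. By Fubini such an average has real part equal to the expectation of
  \<open>sinc (n * x)\<close>, which tends to the mass at 0, while decay of \<open>char M\<close>
  forces it to 0. Rescaling to \<open>[0, 1]\<close> gives a fixed domain for dominated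
  convergence.\<close>

lemma measure_singleton_0_char:
  assumes lim: "(char M \<longlongrightarrow> 0) at_top"
  shows "measure M {0} = 0"
proof -
  have *: "(LBINT u:{0..1}. Re (char M (real n * u))) = (\<integral>x. sinc (real n * x) \<partial>M)" for n
  proof -
    have int01: "(LBINT u:{0..1}. cos (real n * u * x)) = sinc (real n * x)" for x
    proof (cases "real n * x = 0")
      case False
      have "(LBINT u:{0..1}. cos (real n * u * x)) = (\<integral>u. cos (real n * u * x) * indicator {0..1} u \<partial>lborel)"
        by (simp add: set_lebesgue_integral_def mult.commute)
      also have "\<dots> = sin (real n * 1 * x) / (real n * x) - sin (real n * 0 * x) / (real n * x)"
        using False
        by (intro integral_FTC_Icc_real[where F = "\<lambda>u. sin (real n * u * x) / (real n * x)"])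
           (auto intro!: derivative_eq_intros continuous_intros simp: field_simps)
      finally show ?thesis using False by simp
    qed (auto simp: set_lebesgue_integral_def)
    have "(LBINT u:{0..1}. Re (char M (real n * u))) = (LBINT u:{0..1}. (\<integral>x. cos (real n * u * x) \<partial>M))"
      by (simp add: Re_char)
    also have "\<dots> = (\<integral>x. (LBINT u:{0..1}. cos (real n * u * x)) \<partial>M)"
      by (rule set_integral_swap_bounded[where B = 1]) (auto simp: measurable_split_conv)
    finally show ?thesis by (simp only: int01)
  qed
  have "(\<lambda>n. LBINT u:{0..1}. Re (char M (real n * u))) \<longlonglongrightarrow> (LBINT (u::real). (0::real))"
    unfolding set_lebesgue_integral_def
  proof (rule integral_dominated_convergence[where w = "\<lambda>u::real. indicator {0..1} u"])
    show "AE u in lborel. (\<lambda>n. indicator {0..1} u *\<^sub>R Re (char M (real n * u))) \<longlonglongrightarrow> 0"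
      using AE_lborel_singleton[of 0]
    proof eventually_elim
      case (elim u)
      show ?case
      proof (cases "u \<in> {0..1}")
        case True
        then have u: "u > 0" using elim by auto
        have "filterlim (\<lambda>n. real n * u) at_top sequentially"
          using u by (intro filterlim_at_top_mult_tendsto_pos[OF _ _ filterlim_real_sequentially]) auto
        then have "(\<lambda>n. char M (real n * u)) \<longlonglongrightarrow> 0"
          by (rule filterlim_compose[OF lim])
        then have "(\<lambda>n. Re (char M (real n * u))) \<longlonglongrightarrow> Re 0" by (rule tendsto_Re)
        then show ?thesis using True by simp
      qed auto
    qed
    show "AE u in lborel. norm (indicator {0..1} u *\<^sub>R Re (char M (real n * u))) \<le> indicator {0..1} u" for n
      using abs_Re_le_cmod[of "char M (real n * _)"] cmod_char_le_1
      by (intro AE_I2) (auto simp: indicator_def intro: order_trans)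
  qed auto
  then have "(\<lambda>n. \<integral>x. sinc (real n * x) \<partial>M) \<longlonglongrightarrow> 0" by (simp add: *)
  moreover have "(\<lambda>n. \<integral>x. sinc (real n * x) \<partial>M) \<longlonglongrightarrow> (\<integral>x. indicator {0} x \<partial>M)"
  proof (rule integral_dominated_convergence[where w = "\<lambda>_. 1"])
    show "AE x in M. (\<lambda>n. sinc (real n * x)) \<longlonglongrightarrow> indicator {0} x"
    proof (rule AE_I2)
      fix x :: real
      show "(\<lambda>n. sinc (real n * x)) \<longlonglongrightarrow> indicator {0} x"
      proof (cases "x = 0")
        case False
        have "(\<lambda>n. sinc (real n * x)) \<longlonglongrightarrow> 0"
        proof (rule Lim_null_comparison)
          show "\<forall>\<^sub>F n in sequentially. norm (sinc (real n * x)) \<le> (1 / \<bar>x\<bar>) * (1 / real n)"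
            using eventually_gt_at_top[of 0]
          proof eventually_elim
            case (elim n)
            have "norm (sinc (real n * x)) = \<bar>sin (real n * x)\<bar> / (real n * \<bar>x\<bar>)"
              using False elim by (simp add: abs_mult)
            also have "\<dots> \<le> 1 / (real n * \<bar>x\<bar>)" by (intro divide_right_mono) auto
            finally show ?case by (simp add: mult.commute)
          qed
          show "(\<lambda>n. (1 / \<bar>x\<bar>) * (1 / real n)) \<longlonglongrightarrow> 0"
            by (intro tendsto_mult_right_zero lim_1_over_n)
        qed
        then show ?thesis using False by simp
      qed simp
    qed
    show "AE x in M. norm (sinc (real n * x)) \<le> 1" for n
      using abs_sin_x_le_abs_x[of "real n * _"] by (intro AE_I2) (auto simp: divide_le_eq)
  qed auto
  ultimately show ?thesis
    using LIMSEQ_unique by fastforce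
qed

lemma integral_sgn:
  "(\<integral>x. sgn x \<partial>M) = measure M {0<..} - measure M {..<0}"
proof -
  have "(\<integral>x. sgn x \<partial>M) = (\<integral>x. indicator {0<..} x - indicator {..<0::real} x \<partial>M)"
    by (intro Bochner_Integration.integral_cong) (auto simp: sgn_if indicator_def)
  then show ?thesis
    by (subst (asm) Bochner_Integration.integral_diff) (auto simp: emeasure_eq_measure)
qed

text \<open>On a truncated range Fubini turns the integral into an expectation of differences of
  \<open>Si\<close>, which are uniformly bounded and tend to \<open>pi / 2\<close> times the sign of
  \<open>x\<close>. This gives the difference of the masses of the two open half-lines; the absence
  of an atom at 0 then determines the mass of \<open>{..0}\<close>.\<close>

lemma Gil_Pelaez_0:
  assumes lim: "(char M \<longlongrightarrow> 0) at_top"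
    and int: "set_integrable lborel {0<..} (\<lambda>t. Im (char M t) / t)"
  shows "measure M {..0} = 1 / 2 - 1 / pi * (LBINT t:{0<..}. Im (char M t) / t)"
proof -
  \<comment> \<open>The lower cutoff is essential for Fubini: it bounds
    \<open>sin (t * x) / t\<close> by \<open>1 / a n\<close> for all \<open>x\<close>, whereas up to
    \<open>t = 0\<close> the natural bound is \<open>\<bar>x\<bar>\<close>, which may fail to be
    integrable.\<close>
  define a where "a n = inverse (real (Suc n))" for n
  define b where "b n = real (Suc n)" for n
  have a: "a n > 0" "a n \<le> 1" for n by (auto simp: a_def divide_simps)
  have b: "b n \<ge> 1" for n by (simp add: b_def)
  have a0: "a \<longlonglongrightarrow> 0" unfolding a_def[abs_def] by (rule LIMSEQ_inverse_real_of_nat)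
  have btop: "filterlim b at_top sequentially"
    unfolding b_def[abs_def] by (rule filterlim_compose[OF filterlim_real_sequentially filterlim_Suc])
  obtain B where B: "\<And>T. \<bar>Si T\<bar> \<le> B" using bounded_Si by blast
  have eq: "(LBINT t:{a n..b n}. Im (char M t) / t) = (\<integral>x. sgn x * (Si (b n * \<bar>x\<bar>) - Si (a n * \<bar>x\<bar>)) \<partial>M)" for n
  proof -
    have ab: "a n \<le> b n" using a(2)[of n] b[of n] by linarith
    have "(LBINT t:{a n..b n}. Im (char M t) / t) = (LBINT t:{a n..b n}. (\<integral>x. sin (t * x) / t \<partial>M))"
      by (simp add: Im_char)
    also have "\<dots> = (\<integral>x. (LBINT t:{a n..b n}. sin (t * x) / t) \<partial>M)"
    proof (rule set_integral_swap_bounded[where B = "1 / a n"])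
      fix x t assume t: "t \<in> {a n..b n}"
      have "\<bar>sin (t * x) / t\<bar> = \<bar>sin (t * x)\<bar> / t" using t a(1)[of n] by auto
      also have "\<dots> \<le> 1 / a n" using t a(1)[of n] by (intro frac_le) auto
      finally show "\<bar>sin (t * x) / t\<bar> \<le> 1 / a n" .
    qed (use ab in \<open>auto simp: measurable_split_conv\<close>)
    also have "\<dots> = (\<integral>x. sgn x * (Si (b n * \<bar>x\<bar>) - Si (a n * \<bar>x\<bar>)) \<partial>M)"
      using a(1) ab by (simp add: set_integral_sin_div)
    finally show ?thesis .
  qed
  have "(\<lambda>n. LBINT t:{a n..b n}. Im (char M t) / t) \<longlonglongrightarrow> (LBINT t:{0<..}. Im (char M t) / t)"
    unfolding set_lebesgue_integral_def
  proof (rule integral_dominated_convergence)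
    show "integrable lborel (\<lambda>t. norm (indicator {0<..} t *\<^sub>R (Im (char M t) / t)))"
      using int unfolding set_integrable_def by (rule integrable_norm)
    show "AE t in lborel. (\<lambda>n. indicator {a n..b n} t *\<^sub>R (Im (char M t) / t)) \<longlonglongrightarrow> indicator {0<..} t *\<^sub>R (Im (char M t) / t)"
    proof (intro AE_I2 tendsto_scaleR tendsto_const)
      fix t :: real
      show "(\<lambda>n. indicator {a n..b n} t) \<longlonglongrightarrow> (indicator {0<..} t :: real)"
      proof (cases "t > 0")
        case True
        have "\<forall>\<^sub>F n in sequentially. a n < t" using order_tendstoD(2)[OF a0 True] .
        moreover have "\<forall>\<^sub>F n in sequentially. t \<le> b n" using btop by (simp add: filterlim_at_top)
        ultimately have "\<forall>\<^sub>F n in sequentially. indicator {a n..b n} t = (1::real)"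
          by eventually_elim auto
        then show ?thesis using True by (simp add: tendsto_eventually)
      next
        case False
        then have "indicator {a n..b n} t = (0::real)" for n using a(1)[of n] by (auto simp: indicator_def)
        then show ?thesis using False by simp
      qed
    qed
    show "AE t in lborel. norm (indicator {a n..b n} t *\<^sub>R (Im (char M t) / t)) \<le> norm (indicator {0<..} t *\<^sub>R (Im (char M t) / t))" for n
      using a(1)[of n] by (intro AE_I2) (auto simp: indicator_def)
  qed auto
  moreover have "(\<lambda>n. LBINT t:{a n..b n}. Im (char M t) / t) \<longlonglongrightarrow> (\<integral>x. sgn x * (pi / 2 - Si 0) \<partial>M)"
    unfolding eq
  proof (rule integral_dominated_convergence[where w = "\<lambda>_. 2 * B"])
    show "AE x in M. (\<lambda>n. sgn x * (Si (b n * \<bar>x\<bar>) - Si (a n * \<bar>x\<bar>))) \<longlonglongrightarrow> sgn x * (pi / 2 - Si 0)"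
    proof (rule AE_I2)
      fix x :: real
      show "(\<lambda>n. sgn x * (Si (b n * \<bar>x\<bar>) - Si (a n * \<bar>x\<bar>))) \<longlonglongrightarrow> sgn x * (pi / 2 - Si 0)"
      proof (cases "x = 0")
        case False
        have "filterlim (\<lambda>n. b n * \<bar>x\<bar>) at_top sequentially"
          using False by (intro filterlim_at_top_mult_tendsto_pos[OF _ _ btop]) auto
        then have 1: "(\<lambda>n. Si (b n * \<bar>x\<bar>)) \<longlonglongrightarrow> pi / 2"
          by (rule filterlim_compose[OF Si_at_top])
        have "(\<lambda>n. a n * \<bar>x\<bar>) \<longlonglongrightarrow> 0" using a0 by (rule tendsto_mult_left_zero)
        then have "(\<lambda>n. Si (a n * \<bar>x\<bar>)) \<longlonglongrightarrow> Si 0"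
          by (rule isCont_tendsto_compose[OF isCont_Si])
        then show ?thesis by (intro tendsto_intros 1)
      qed simp
    qed
    show "AE x in M. norm (sgn x * (Si (b n * \<bar>x\<bar>) - Si (a n * \<bar>x\<bar>))) \<le> 2 * B" for n
    proof (rule AE_I2)
      fix x
      have "\<bar>Si (b n * \<bar>x\<bar>) - Si (a n * \<bar>x\<bar>)\<bar> \<le> 2 * B"
        using B[of "b n * \<bar>x\<bar>"] B[of "a n * \<bar>x\<bar>"] by linarith
      moreover have "0 \<le> B" using B[of 0] by linarith
      ultimately show "norm (sgn x * (Si (b n * \<bar>x\<bar>) - Si (a n * \<bar>x\<bar>))) \<le> 2 * B"
        by (auto simp: abs_mult sgn_if)
    qed
  qed auto
  ultimately have I: "(LBINT t:{0<..}. Im (char M t) / t) = (\<integral>x. sgn x * (pi / 2 - Si 0) \<partial>M)"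
    by (rule LIMSEQ_unique)
  have "Si 0 = 0" by (simp add: Si_def zero_ereal_def)
  then have "(LBINT t:{0<..}. Im (char M t) / t) = pi / 2 * (measure M {0<..} - measure M {..<0})"
    using I by (simp add: integral_sgn)
  moreover have "measure M {0<..} = 1 - measure M {..0}"
  proof -
    have "space M - {..0} = {0<..}" by auto
    then show ?thesis using prob_compl[of "{..0}"] by simp
  qed
  moreover have "measure M {..0} = measure M {..<0} + measure M {0}"
    by (subst finite_measure_Union[symmetric]) (auto intro!: arg_cong[where f = "measure M"])
  ultimately show ?thesis
    using measure_singleton_0_char[OF lim] by (simp add: field_simps)
qed

end

section \<open>Estimates for the characteristic function\<close>

lemma
  fixes y \<gamma> :: real
  shows Re_one_minus_powr: "Re ((1 - \<i> * of_real y) powr of_real \<gamma>) = (1 + y\<^sup>2) powr (\<gamma> / 2) * cos (\<gamma> * arctan y)"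
    and Im_one_minus_powr: "Im ((1 - \<i> * of_real y) powr of_real \<gamma>) = - ((1 + y\<^sup>2) powr (\<gamma> / 2) * sin (\<gamma> * arctan y))"
proof -
  have "norm (1 - \<i> * complex_of_real y) = (1 + y\<^sup>2) powr (1 / 2)"
    by (simp add: cmod_def powr_half_sqrt)
  then have n: "norm (1 - \<i> * complex_of_real y) powr \<gamma> = (1 + y\<^sup>2) powr (\<gamma> / 2)"
    by (simp add: powr_powr)
  show "Re ((1 - \<i> * of_real y) powr of_real \<gamma>) = (1 + y\<^sup>2) powr (\<gamma> / 2) * cos (\<gamma> * arctan y)"
    "Im ((1 - \<i> * of_real y) powr of_real \<gamma>) = - ((1 + y\<^sup>2) powr (\<gamma> / 2) * sin (\<gamma> * arctan y))"
    by (simp_all add: Re_Im_powr_of_real n arctan_minus)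
qed

lemma abs_powr_eq_square_powr: "\<bar>y\<bar> powr \<gamma> = (y\<^sup>2) powr (\<gamma> / 2)" for y \<gamma> :: real
proof -
  have "y\<^sup>2 = \<bar>y\<bar> powr 2" by (cases "y = 0") simp_all
  then have "(y\<^sup>2) powr (\<gamma> / 2) = (\<bar>y\<bar> powr 2) powr (\<gamma> / 2)" by (simp only:)
  then show ?thesis by (simp only: powr_powr) simp
qed

lemma powr_le_powr_half:
  fixes y \<gamma> :: real
  assumes "0 \<le> \<gamma>"
  shows "1 \<le> (1 + y\<^sup>2) powr (\<gamma> / 2)" "\<bar>y\<bar> powr \<gamma> \<le> (1 + y\<^sup>2) powr (\<gamma> / 2)"
proof -
  show "1 \<le> (1 + y\<^sup>2) powr (\<gamma> / 2)" using assms by (intro ge_one_powr_ge_zero) auto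
  show "\<bar>y\<bar> powr \<gamma> \<le> (1 + y\<^sup>2) powr (\<gamma> / 2)"
    unfolding abs_powr_eq_square_powr using assms by (intro powr_mono2) auto
qed

text \<open>The angle \<open>\<gamma> * arctan y\<close> stays within
  \<open>\<gamma> * pi / 2\<close>, strictly inside the right half-plane as
  \<open>\<gamma> < 1\<close>. This uniform gap keeps the real part of the power comparable to its
  modulus.\<close>

lemma cos_arctan_ge:
  assumes "0 < \<gamma>" "\<gamma> < 1"
  shows "cos (\<gamma> * pi / 2) \<le> cos (\<gamma> * arctan y)"
proof -
  have "\<bar>arctan y\<bar> \<le> pi / 2" using arctan_bounded[of y] by (auto simp: abs_le_iff)
  then have "\<bar>\<gamma> * arctan y\<bar> \<le> \<gamma> * (pi / 2)"
    unfolding abs_mult using assms by (intro mult_mono) auto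
  moreover have "\<gamma> * (pi / 2) \<le> pi" using assms mult_right_mono[of \<gamma> 1 "pi / 2"] by simp
  ultimately have "cos (\<gamma> * (pi / 2)) \<le> cos \<bar>\<gamma> * arctan y\<bar>"
    by (intro cos_monotone_0_pi_le) auto
  then show ?thesis by simp
qed

lemma cos_half_pi_pos:
  assumes "0 < \<gamma>" "\<gamma> < 1"
  shows "0 < cos (\<gamma> * pi / 2)"
  using assms by (intro cos_gt_zero) auto

text \<open>Two bounds for two regimes: after integration the constant keeps the real part away from
  0 for all \<open>t\<close>, and the power makes it grow with \<open>t\<close>.\<close>

lemma Re_one_minus_powr_ge:
  assumes "0 < \<gamma>" "\<gamma> < 1"
  shows "cos (\<gamma> * pi / 2) \<le> Re ((1 - \<i> * of_real y) powr of_real \<gamma>)"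
    and "cos (\<gamma> * pi / 2) * \<bar>y\<bar> powr \<gamma> \<le> Re ((1 - \<i> * of_real y) powr of_real \<gamma>)"
proof -
  have c: "0 < cos (\<gamma> * pi / 2)" "cos (\<gamma> * pi / 2) \<le> cos (\<gamma> * arctan y)"
    using assms by (simp_all add: cos_half_pi_pos cos_arctan_ge)
  show "cos (\<gamma> * pi / 2) \<le> Re ((1 - \<i> * of_real y) powr of_real \<gamma>)"
    using mult_mono[OF powr_le_powr_half(1)[of \<gamma> y] c(2)] c assms by (simp add: Re_one_minus_powr)
  show "cos (\<gamma> * pi / 2) * \<bar>y\<bar> powr \<gamma> \<le> Re ((1 - \<i> * of_real y) powr of_real \<gamma>)"
    using mult_mono[OF powr_le_powr_half(2)[of \<gamma> y] c(2)] c assms by (simp add: Re_one_minus_powr mult.commute)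
qed

text \<open>For \<open>\<bar>y\<bar> \<le> 1\<close> the sine is at most
  \<open>\<bar>y\<bar>\<close>, hence at most \<open>\<bar>y\<bar> powr \<gamma>\<close>; for larger
  \<open>y\<close> one has \<open>1 + y\<^sup>2 \<le> 2 * y\<^sup>2\<close>. Giving up the linear
  order near 0 is deliberate: with \<open>y = t * h x\<close> only the power \<open>\<gamma>\<close>
  can be integrated over \<open>x\<close>.\<close>

lemma Im_one_minus_powr_le:
  assumes "0 < \<gamma>" "\<gamma> < 1"
  shows "\<bar>Im ((1 - \<i> * of_real y) powr of_real \<gamma>)\<bar> \<le> 2 * \<bar>y\<bar> powr \<gamma>"
proof (cases "\<bar>y\<bar> \<le> 1")
  case True
  have "(1 + y\<^sup>2) powr (\<gamma> / 2) \<le> 2 powr (\<gamma> / 2)"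
    using True assms by (intro powr_mono2) (auto simp: abs_square_le_1)
  also have "\<dots> \<le> 2 powr 1" using assms by (intro powr_mono) auto
  finally have 1: "(1 + y\<^sup>2) powr (\<gamma> / 2) \<le> 2" by simp
  have "\<bar>sin (\<gamma> * arctan y)\<bar> \<le> \<gamma> * \<bar>arctan y\<bar>"
    using abs_sin_x_le_abs_x[of "\<gamma> * arctan y"] assms by (simp add: abs_mult)
  also have "\<dots> \<le> 1 * \<bar>y\<bar>" using assms abs_arctan_le[of y] by (intro mult_mono) auto
  also have "\<dots> \<le> \<bar>y\<bar> powr \<gamma>"
    using powr_mono'[of \<gamma> 1 "\<bar>y\<bar>"] True assms by simp
  finally have "(1 + y\<^sup>2) powr (\<gamma> / 2) * \<bar>sin (\<gamma> * arctan y)\<bar> \<le> 2 * \<bar>y\<bar> powr \<gamma>"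
    using 1 by (intro mult_mono) auto
  then show ?thesis by (simp add: Im_one_minus_powr abs_mult)
next
  case False
  then have "1 \<le> y\<^sup>2" using abs_le_square_iff[of 1 y] by simp
  then have "(1 + y\<^sup>2) powr (\<gamma> / 2) \<le> (2 * y\<^sup>2) powr (\<gamma> / 2)"
    using assms by (intro powr_mono2) auto
  also have "\<dots> = 2 powr (\<gamma> / 2) * \<bar>y\<bar> powr \<gamma>"
    unfolding abs_powr_eq_square_powr by (rule powr_mult)
  also have "\<dots> \<le> 2 powr 1 * \<bar>y\<bar> powr \<gamma>" using assms by (intro mult_right_mono powr_mono) auto
  finally have "(1 + y\<^sup>2) powr (\<gamma> / 2) * \<bar>sin (\<gamma> * arctan y)\<bar> \<le> (2 * \<bar>y\<bar> powr \<gamma>) * 1"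
    by (intro mult_mono) auto
  then show ?thesis by (simp add: Im_one_minus_powr abs_mult)
qed

text \<open>The first bound is integrable on \<open>{0<..1}\<close>, the second on
  \<open>{1..}\<close>. The intended exponents are \<open>a = \<gamma>\<close> and
  \<open>b = \<theta>\<close>.\<close>

lemma set_integrable_powr_bounds:
  fixes f :: "real \<Rightarrow> real"
  assumes [measurable]: "f \<in> borel_measurable borel" and a: "0 < a" and b: "0 < b"
    and f0: "\<And>t. 0 < t \<Longrightarrow> \<bar>f t\<bar> \<le> c * t powr (a - 1)"
    and f1: "\<And>t. 0 < t \<Longrightarrow> \<bar>f t\<bar> \<le> d * t powr (- b - 1)"
  shows "set_integrable lborel {0<..} f"
proof -
  have "set_integrable lborel {0<..1} (\<lambda>t. c * (t powr (a - 1)))"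
  proof (rule set_integrable_mult_right)
    have "(\<integral>\<^sup>+t. ennreal (indicator {0<..1} t *\<^sub>R (a * t powr (a - 1))) \<partial>lborel) = (\<integral>\<^sup>+t\<in>{0<..1}. ennreal (a * t powr (a - 1)) \<partial>lborel)"
      by (intro nn_integral_cong) (auto simp: indicator_def)
    then have "set_integrable lborel {0<..1} (\<lambda>t. a * t powr (a - 1))"
      unfolding set_integrable_def using a nn_integral_powr_0[OF a, of 1] by (intro integrableI_nonneg) auto
    then show "set_integrable lborel {0<..1} (\<lambda>t. t powr (a - 1))"
      using a by simp
  qed
  then have 0: "set_integrable lborel {0<..1} f"
    by (rule set_integrable_bound) (auto intro!: AE_I2 order_trans[OF f0] simp: set_borel_measurable_def)
  have "((\<lambda>t. t powr (- b - 1)) has_integral - (1 powr (- b - 1 + 1)) / (- b - 1 + 1)) {1..}"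
    using b by (intro has_integral_powr_to_inf) auto
  then have "(\<integral>\<^sup>+t\<in>{1..}. ennreal (t powr (- b - 1)) \<partial>lborel) = ennreal (1 / b)"
    using b by (subst nn_integral_has_integral_lebesgue') auto
  moreover have "(\<integral>\<^sup>+t. ennreal (indicator {1..} t *\<^sub>R (t powr (- b - 1))) \<partial>lborel) = (\<integral>\<^sup>+t\<in>{1..}. ennreal (t powr (- b - 1)) \<partial>lborel)"
    by (intro nn_integral_cong) (auto simp: indicator_def)
  ultimately have "set_integrable lborel {1..} (\<lambda>t. t powr (- b - 1))"
    unfolding set_integrable_def by (intro integrableI_nonneg) auto
  then have "set_integrable lborel {1..} (\<lambda>t. d * t powr (- b - 1))"
    by (rule set_integrable_mult_right)
  then have 1: "set_integrable lborel {1..} f"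
    by (rule set_integrable_bound) (auto intro!: AE_I2 order_trans[OF f1] simp: set_borel_measurable_def)
  have "{0<..1} \<union> {1..} = {0::real<..}" by auto
  then show ?thesis
    using set_integrable_Un[OF 0 1] by simp
qed

context finite_measure
begin

context
  fixes h :: "'a \<Rightarrow> real" and \<gamma> :: real
  assumes h_meas [measurable]: "h \<in> borel_measurable M"
    and h: "integrable M (\<lambda>x. \<bar>h x\<bar> powr \<gamma>)" and \<gamma>: "0 < \<gamma>" "\<gamma> < 1"
begin

lemma integrable_one_minus_powr:
  "complex_integrable M (\<lambda>x. (1 - \<i> * of_real (t * h x)) powr of_real \<gamma>)"
  using integrable_cpowr_affine[OF h_meas h, of 1 0 "- (\<i> * of_real t)"] \<gamma> by (simp add: mult_ac)

lemma Re_integral_one_minus_powr_ge: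
  shows "cos (\<gamma> * pi / 2) * measure M (space M) \<le> Re (CLINT x|M. (1 - \<i> * of_real (t * h x)) powr of_real \<gamma>)"
    and "cos (\<gamma> * pi / 2) * (\<bar>t\<bar> powr \<gamma> * (\<integral>x. \<bar>h x\<bar> powr \<gamma> \<partial>M)) \<le> Re (CLINT x|M. (1 - \<i> * of_real (t * h x)) powr of_real \<gamma>)"
proof -
  note i = integrable_one_minus_powr[of t]
  have Re: "Re (CLINT x|M. (1 - \<i> * of_real (t * h x)) powr of_real \<gamma>) = (\<integral>x. Re ((1 - \<i> * of_real (t * h x)) powr of_real \<gamma>) \<partial>M)"
    by (rule integral_Re[OF i, symmetric])
  have "(\<integral>x. cos (\<gamma> * pi / 2) \<partial>M) \<le> (\<integral>x. Re ((1 - \<i> * of_real (t * h x)) powr of_real \<gamma>) \<partial>M)"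
    using i by (intro integral_mono integrable_Re Re_one_minus_powr_ge \<gamma>) auto
  then show "cos (\<gamma> * pi / 2) * measure M (space M) \<le> Re (CLINT x|M. (1 - \<i> * of_real (t * h x)) powr of_real \<gamma>)"
    unfolding Re by (simp add: mult.commute)
  have "(\<integral>x. cos (\<gamma> * pi / 2) * (\<bar>t\<bar> powr \<gamma> * \<bar>h x\<bar> powr \<gamma>) \<partial>M) \<le> (\<integral>x. Re ((1 - \<i> * of_real (t * h x)) powr of_real \<gamma>) \<partial>M)"
  proof (intro integral_mono integrable_Re i)
    show "cos (\<gamma> * pi / 2) * (\<bar>t\<bar> powr \<gamma> * \<bar>h x\<bar> powr \<gamma>) \<le> Re ((1 - \<i> * of_real (t * h x)) powr of_real \<gamma>)" for x
      using Re_one_minus_powr_ge(2)[OF \<gamma>, of "t * h x"] by (simp only: abs_mult powr_mult abs_ge_zero)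
  qed (use h in auto)
  then show "cos (\<gamma> * pi / 2) * (\<bar>t\<bar> powr \<gamma> * (\<integral>x. \<bar>h x\<bar> powr \<gamma> \<partial>M)) \<le> Re (CLINT x|M. (1 - \<i> * of_real (t * h x)) powr of_real \<gamma>)"
    unfolding Re by simp
qed

lemma Im_integral_one_minus_powr_le:
  "\<bar>Im (CLINT x|M. (1 - \<i> * of_real (t * h x)) powr of_real \<gamma>)\<bar> \<le> 2 * (\<bar>t\<bar> powr \<gamma> * (\<integral>x. \<bar>h x\<bar> powr \<gamma> \<partial>M))"
proof -
  note i = integrable_one_minus_powr[of t]
  have "\<bar>Im (CLINT x|M. (1 - \<i> * of_real (t * h x)) powr of_real \<gamma>)\<bar> = \<bar>\<integral>x. Im ((1 - \<i> * of_real (t * h x)) powr of_real \<gamma>) \<partial>M\<bar>"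
    by (simp only: integral_Im[OF i, symmetric])
  also have "\<dots> \<le> (\<integral>x. \<bar>Im ((1 - \<i> * of_real (t * h x)) powr of_real \<gamma>)\<bar> \<partial>M)"
    by (rule integral_abs_bound)
  also have "\<dots> \<le> (\<integral>x. 2 * (\<bar>t\<bar> powr \<gamma> * \<bar>h x\<bar> powr \<gamma>) \<partial>M)"
  proof (intro integral_mono integrable_abs integrable_Im i)
    show "\<bar>Im ((1 - \<i> * of_real (t * h x)) powr of_real \<gamma>)\<bar> \<le> 2 * (\<bar>t\<bar> powr \<gamma> * \<bar>h x\<bar> powr \<gamma>)" for x
      using Im_one_minus_powr_le[OF \<gamma>, of "t * h x"] by (simp only: abs_mult powr_mult abs_ge_zero)
  qed (use h in auto)
  finally show ?thesis by simp
qed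

end

end

section \<open>Passage to the real integrand and assembly of the formula\<close>

lemma A_B_fun_normalized:
  fixes \<alpha> :: "'a::polish_space measure"
  assumes sets_\<alpha> [measurable_cong]: "sets \<alpha> = sets borel" and fin: "finite_measure \<alpha>"
    and pos: "0 < measure \<alpha> UNIV"
    and g [measurable]: "g \<in> borel_measurable borel"
    and h: "integrable \<alpha> (\<lambda>x. \<bar>g x - \<sigma>\<bar> powr \<gamma>)" and \<gamma>: "0 < \<gamma>" "\<gamma> < 1"
  shows "(CLINT x|\<alpha>. (1 - \<i> * of_real (t * (g x - \<sigma>))) powr of_real \<gamma>)
    = of_real (measure \<alpha> UNIV) * Complex (A_fun \<gamma> (normalized \<alpha>) g \<sigma> t) (- B_fun \<gamma> (normalized \<alpha>) g \<sigma> t)"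
proof -
  interpret finite_measure \<alpha> by fact
  have sp: "space \<alpha> = UNIV" using sets_eq_imp_space_eq[OF sets_\<alpha>] by simp
  have i: "complex_integrable \<alpha> (\<lambda>x. (1 - \<i> * of_real (t * (g x - \<sigma>))) powr of_real \<gamma>)"
    by (rule integrable_one_minus_powr[OF _ h \<gamma>]) measurable
  have "A_fun \<gamma> (normalized \<alpha>) g \<sigma> t = (\<integral>x. Re ((1 - \<i> * of_real (t * (g x - \<sigma>))) powr of_real \<gamma>) \<partial>\<alpha>) / measure \<alpha> UNIV"
    unfolding A_fun_def by (subst integral_normalized) (auto simp: sp Re_one_minus_powr power_mult_distrib simp del: of_real_mult)
  then have A: "measure \<alpha> UNIV * A_fun \<gamma> (normalized \<alpha>) g \<sigma> t = Re (CLINT x|\<alpha>. (1 - \<i> * of_real (t * (g x - \<sigma>))) powr of_real \<gamma>)"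
    using pos integral_Re[OF i] by simp
  have "B_fun \<gamma> (normalized \<alpha>) g \<sigma> t = - (\<integral>x. Im ((1 - \<i> * of_real (t * (g x - \<sigma>))) powr of_real \<gamma>) \<partial>\<alpha>) / measure \<alpha> UNIV"
    unfolding B_fun_def by (subst integral_normalized) (auto simp: sp Im_one_minus_powr power_mult_distrib simp del: of_real_mult)
  then have B: "measure \<alpha> UNIV * - B_fun \<gamma> (normalized \<alpha>) g \<sigma> t = Im (CLINT x|\<alpha>. (1 - \<i> * of_real (t * (g x - \<sigma>))) powr of_real \<gamma>)"
    using pos integral_Im[OF i] by simp
  show ?thesis
    using A B by (intro complex_eqI) simp_all
qed

text \<open>The factor \<open>a powr p\<close> cancels the mass of \<open>\<alpha>\<close>, so only
  quantities of the normalised base measure survive. The sign of \<open>- B\<close> and the sign of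
  the exponent compensate in the odd functions \<open>arctan\<close> and \<open>sin\<close>.\<close>

lemma Im_Complex_powr:
  fixes A B a p :: real
  assumes "0 < A" "0 < a"
  shows "a powr p * Im ((of_real a * Complex A (- B)) powr of_real (- p)) = sin (p * arctan (B / A)) / (A\<^sup>2 + B\<^sup>2) powr (p / 2)"
proof -
  have "norm (of_real a * Complex A (- B)) = a * (A\<^sup>2 + B\<^sup>2) powr (1 / 2)"
    using assms by (simp only: norm_mult norm_of_real) (simp add: cmod_def powr_half_sqrt)
  then have n: "norm (of_real a * Complex A (- B)) powr (- p) = a powr (- p) * (A\<^sup>2 + B\<^sup>2) powr (- p / 2)"
    using assms by (simp add: powr_mult powr_powr)
  have "Im ((of_real a * Complex A (- B)) powr of_real (- p)) = norm (of_real a * Complex A (- B)) powr (- p) * sin (- p * arctan (- B / A))"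
    using assms by (subst Re_Im_powr_of_real) auto
  then show ?thesis
    unfolding n using assms by (simp add: arctan_minus powr_minus field_simps)
qed

text \<open>If \<open>g\<close> equals \<open>\<sigma>\<close> almost everywhere, the mean is almost
  surely \<open>\<sigma>\<close>: the distribution function is 1 there, while the integrand vanishes
  and the formula would give 1/2. The last hypothesis excludes this case. Otherwise the integral
  converges absolutely, so it is a genuine Lebesgue integral.\<close>

theorem proposition4p6:
  fixes \<gamma> \<theta> \<sigma> :: real
    and \<alpha> P0 :: "'a::polish_space measure"
    and g :: "'a \<Rightarrow> real"
    and S :: "'s measure" and \<mu>\<^sub>\<gamma> :: "'s \<Rightarrow> 'a measure"
    and W :: "'w measure" and \<mu>\<^sub>\<gamma>\<^sub>\<theta> P :: "'w \<Rightarrow> 'a measure"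
  assumes "0 < \<gamma>" and "\<gamma> < 1" and "0 < \<theta>"
    and "sets \<alpha> = sets borel" and "finite_measure \<alpha>" and "non_atomic \<alpha>"
    and "0 < emeasure \<alpha> UNIV"
    and "P0 = normalized \<alpha>"
    and "stable_CRM S \<gamma> \<alpha> \<mu>\<^sub>\<gamma>"
    and "prob_space W" and "\<mu>\<^sub>\<gamma>\<^sub>\<theta> \<in> measurable W bfm_algebra"
    and "distr W bfm_algebra \<mu>\<^sub>\<gamma>\<^sub>\<theta> = tilted_law \<theta> (distr S bfm_algebra \<mu>\<^sub>\<gamma>)"
    and "P = (\<lambda>\<omega>. normalized (\<mu>\<^sub>\<gamma>\<^sub>\<theta> \<omega>))"
    and "g \<in> borel_measurable borel"
    and "\<And>t. 0 < t \<Longrightarrow> (\<integral>\<^sup>+x. ennreal ((1 + t * \<bar>g x\<bar>) powr \<gamma>) \<partial>\<alpha>) < \<infinity>"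
    and "\<not> (AE x in \<alpha>. g x = \<sigma>)"
  shows "set_integrable lborel {0<..} (cdf_integrand \<gamma> \<theta> P0 g \<sigma>) \<and>
    measure W {\<omega> \<in> space W. (\<integral>x. g x \<partial>P \<omega>) \<le> \<sigma>} =
      1 / 2 - 1 / pi * (LBINT t:{0<..}. cdf_integrand \<gamma> \<theta> P0 g \<sigma> t)"
proof -
  note \<gamma> = assms(1,2) and \<theta> = assms(3)
  note [measurable_cong] = assms(4) and [measurable] = assms(11,14)
  interpret W: prob_space W by fact
  interpret \<alpha>: finite_measure \<alpha> by fact
  interpret S: prob_space S using assms(9) by (simp add: stable_CRM_def)
  have tilted: "prob_space (tilted_law \<theta> (distr S bfm_algebra \<mu>\<^sub>\<gamma>))"
    unfolding assms(12)[symmetric] by (rule W.prob_space_distr) measurable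
  interpret T: tilted_stable_CRM S \<alpha> \<gamma> \<mu>\<^sub>\<gamma> \<theta>
    by (intro tilted_stable_CRM.intro tilted_stable_CRM_axioms.intro finite_stable_CRM.intro finite_stable_CRM_axioms.intro)
       (rule S.prob_space_axioms tilted assms)+
  define h where "h x = g x - \<sigma>" for x
  have [measurable]: "h \<in> borel_measurable borel" unfolding h_def[abs_def] by measurable
  have h: "integrable \<alpha> (\<lambda>x. \<bar>h x\<bar> powr \<gamma>)"
  proof (rule Bochner_Integration.integrable_bound)
    have g1: "integrable \<alpha> (\<lambda>x. (1 + 1 * \<bar>g x\<bar>) powr \<gamma>)"
      using assms(15)[of 1] by (intro integrableI_nonneg) auto
    have "integrable \<alpha> (\<lambda>x. \<bar>g x\<bar> powr \<gamma>)"
      using \<gamma> by (intro Bochner_Integration.integrable_bound[OF g1]) (auto intro!: powr_mono2)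
    then show "integrable \<alpha> (\<lambda>x. (\<bar>\<sigma>\<bar> + 1 * \<bar>g x\<bar>) powr \<gamma>)"
      using \<gamma> by (intro \<alpha>.integrable_powr_affine) auto
    show "AE x in \<alpha>. norm (\<bar>h x\<bar> powr \<gamma>) \<le> norm ((\<bar>\<sigma>\<bar> + 1 * \<bar>g x\<bar>) powr \<gamma>)"
      using \<gamma> by (auto simp: h_def intro!: AE_I2 powr_mono2)
  qed measurable
  have h': "integrable \<alpha> (\<lambda>x. \<bar>g x - \<sigma>\<bar> powr \<gamma>)" using h by (simp add: h_def)
  define a where "a = measure \<alpha> UNIV"
  have a: "a > 0" using assms(7) by (simp add: a_def \<alpha>.emeasure_eq_measure)
  have sp: "space \<alpha> = UNIV" using sets_eq_imp_space_eq[OF assms(4)] by simp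
  define H where "H = (\<integral>x. \<bar>h x\<bar> powr \<gamma> \<partial>\<alpha>)"
  \<comment> \<open>Here the excluded case enters: a positive \<open>H\<close> is what makes
    \<open>K\<close> grow, and so the characteristic function decay.\<close>
  have H: "H > 0"
  proof -
    have "H \<noteq> 0"
    proof
      assume "H = 0"
      then have "AE x in \<alpha>. \<bar>h x\<bar> powr \<gamma> = 0"
        using h unfolding H_def by (subst (asm) integral_nonneg_eq_0_iff_AE) auto
      then have "AE x in \<alpha>. g x = \<sigma>" by eventually_elim (simp add: h_def)
      then show False using assms(16) by simp
    qed
    moreover have "H \<ge> 0" unfolding H_def by (intro Bochner_Integration.integral_nonneg) auto
    ultimately show ?thesis by simp
  qed
  define c where "c = cos (\<gamma> * pi / 2)"
  have c: "c > 0" using \<gamma> by (simp add: c_def cos_half_pi_pos)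
  define p where "p = \<theta> / \<gamma>"
  have p: "p > 0" using \<gamma> \<theta> by (simp add: p_def)
  define K where "K t = (CLINT x|\<alpha>. (1 - \<i> * of_real (t * h x)) powr of_real \<gamma>)" for t
  have hm: "h \<in> borel_measurable \<alpha>" by measurable
  have K1: "c * a \<le> Re (K t)" for t
    using \<alpha>.Re_integral_one_minus_powr_ge(1)[OF hm h \<gamma>, of t] by (simp add: K_def c_def a_def sp)
  have K2: "c * (t powr \<gamma> * H) \<le> Re (K t)" if "0 < t" for t
    using \<alpha>.Re_integral_one_minus_powr_ge(2)[OF hm h \<gamma>, of t] that by (simp add: K_def c_def H_def)
  have K3: "\<bar>Im (K t)\<bar> \<le> 2 * (t powr \<gamma> * H)" if "0 < t" for t
    using \<alpha>.Im_integral_one_minus_powr_le[OF hm h \<gamma>, of t] that by (simp add: K_def H_def)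
  have ReK: "0 < Re (K t)" for t
    using K1[of t] mult_pos_pos[OF c a] by linarith
  have K0: "K t \<noteq> 0" for t using ReK[of t] by auto
  define Z where "Z = T.Z_law h"
  interpret Z: real_distribution Z
    unfolding Z_def by (rule T.real_distribution_Z_law[OF _ h]) measurable
  have char: "char Z t = of_real (a powr p) * K t powr of_real (- p)" for t
    using T.char_Z_law[OF _ h, of t] ReK[of t] by (simp add: Z_def K_def a_def p_def)
  define A where "A t = A_fun \<gamma> P0 g \<sigma> t" for t
  define B where "B t = B_fun \<gamma> P0 g \<sigma> t" for t
  have K_AB: "K t = of_real a * Complex (A t) (- B t)" for t
    using A_B_fun_normalized[OF assms(4,5) _ assms(14) h' \<gamma>] a by (simp add: K_def A_def B_def a_def assms(8) h_def)
  have A: "0 < A t" for t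
    using ReK[of t] a by (simp add: K_AB zero_less_mult_iff)
  have integrand: "Im (char Z t) / t = cdf_integrand \<gamma> \<theta> P0 g \<sigma> t" for t
  proof -
    have "Im (char Z t) = a powr p * Im ((of_real a * Complex (A t) (- B t)) powr of_real (- p))"
      by (simp add: char K_AB)
    also have "\<dots> = sin (p * arctan (B t / A t)) / ((A t)\<^sup>2 + (B t)\<^sup>2) powr (p / 2)"
      by (rule Im_Complex_powr[OF A a])
    finally show ?thesis
      by (simp add: cdf_integrand_def A_def B_def p_def mult.commute[of \<gamma> 2])
  qed
  have normK: "norm (K t powr of_real (- p)) = norm (K t) powr (- p)" for t
    by (rule norm_powr_complex_of_real[OF K0])
  \<comment> \<open>For large \<open>t\<close>: the real part of \<open>K t\<close> grows at least
    like \<open>t powr \<gamma>\<close>, and \<open>\<gamma> * p = \<theta>\<close>.\<close>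
  have bound1: "norm (char Z t) \<le> a powr p * (c * H) powr (- p) * t powr (- \<theta>)" if t: "0 < t" for t
  proof -
    have "norm (char Z t) = a powr p * norm (K t) powr (- p)"
      using a by (simp only: char norm_mult normK norm_of_real) simp
    also have "norm (K t) powr (- p) \<le> (c * (t powr \<gamma> * H)) powr (- p)"
      using K2[OF t] complex_Re_le_cmod[of "K t"] c H t p by (intro powr_mono2') auto
    also have "(c * (t powr \<gamma> * H)) powr (- p) = (c * H) powr (- p) * t powr (- \<theta>)"
      using c H t \<gamma> by (simp add: powr_mult powr_powr p_def)
    finally show ?thesis by (simp add: mult.assoc mult_left_mono)
  qed
  \<comment> \<open>For small \<open>t\<close>: the modulus of \<open>K t\<close> is at least
    \<open>c * a\<close>, and its argument is at most
    \<open>\<bar>Im (K t)\<bar> / Re (K t)\<close>, of order \<open>t powr \<gamma>\<close>.\<close>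
  have bound2: "\<bar>Im (char Z t)\<bar> \<le> (c powr (- p) * (p * (2 * H / (c * a)))) * t powr \<gamma>" if t: "0 < t" for t
  proof -
    have "\<bar>Im (char Z t)\<bar> = a powr p * (norm (K t) powr (- p) * \<bar>sin (- p * arctan (Im (K t) / Re (K t)))\<bar>)"
    proof -
      have "Im (char Z t) = a powr p * Im (K t powr of_real (- p))" by (simp add: char)
      also have "\<dots> = a powr p * (norm (K t) powr (- p) * sin (- p * arctan (Im (K t) / Re (K t))))"
        by (subst Re_Im_powr_of_real(2)[OF ReK]) simp
      finally show ?thesis by (simp add: abs_mult)
    qed
    also have "\<dots> \<le> a powr p * ((c * a) powr (- p) * (p * (2 * (t powr \<gamma> * H) / (c * a))))"
    proof (intro mult_left_mono mult_mono)
      show "norm (K t) powr (- p) \<le> (c * a) powr (- p)"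
        using K1[of t] complex_Re_le_cmod[of "K t"] c a p by (intro powr_mono2') auto
      have "\<bar>sin (- p * arctan (Im (K t) / Re (K t)))\<bar> \<le> \<bar>- p * arctan (Im (K t) / Re (K t))\<bar>"
        by (rule abs_sin_x_le_abs_x)
      also have "\<dots> \<le> p * (\<bar>Im (K t)\<bar> / Re (K t))"
        using mult_left_mono[OF abs_arctan_le[of "Im (K t) / Re (K t)"], of p] p ReK[of t] by (simp add: abs_mult)
      also have "\<dots> \<le> p * (2 * (t powr \<gamma> * H) / (c * a))"
        using p K1[of t] K3[OF t] c a H by (intro mult_left_mono frac_le) auto
      finally show "\<bar>sin (- p * arctan (Im (K t) / Re (K t)))\<bar> \<le> p * (2 * (t powr \<gamma> * H) / (c * a))" .
    qed auto
    also have "\<dots> = (c powr (- p) * (p * (2 * H / (c * a)))) * t powr \<gamma>"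
      using a c by (simp add: powr_mult powr_minus field_simps)
    finally show ?thesis .
  qed
  have lim: "(char Z \<longlongrightarrow> 0) at_top"
  proof (rule Lim_null_comparison)
    show "\<forall>\<^sub>F t in at_top. norm (char Z t) \<le> a powr p * (c * H) powr (- p) * t powr (- \<theta>)"
      using eventually_gt_at_top[of 0] by eventually_elim (rule bound1)
    show "((\<lambda>t. a powr p * (c * H) powr (- p) * t powr (- \<theta>)) \<longlongrightarrow> 0) at_top"
      using \<theta> by (intro tendsto_mult_right_zero tendsto_neg_powr filterlim_ident) auto
  qed
  have int: "set_integrable lborel {0<..} (\<lambda>t. Im (char Z t) / t)"
  \<comment> \<open>Division by \<open>t\<close> lowers both exponents by one: \<open>bound2\<close>
    gives \<open>\<gamma> - 1\<close> for the behaviour at 0 and \<open>bound1\<close> gives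
    \<open>- \<theta> - 1\<close> for infinity.\<close>
  proof (rule set_integrable_powr_bounds[OF _ \<gamma>(1) \<theta>])
    fix t :: real assume t: "0 < t"
    show "\<bar>Im (char Z t) / t\<bar> \<le> (c powr (- p) * (p * (2 * H / (c * a)))) * t powr (\<gamma> - 1)"
      using divide_right_mono[OF bound2[OF t], of t] t by (simp add: powr_diff)
    have "\<bar>Im (char Z t)\<bar> \<le> a powr p * (c * H) powr (- p) * t powr (- \<theta>)"
      using abs_Im_le_cmod[of "char Z t"] bound1[OF t] by linarith
    then show "\<bar>Im (char Z t) / t\<bar> \<le> (a powr p * (c * H) powr (- p)) * t powr (- \<theta> - 1)"
      using divide_right_mono[of _ _ t] t by (simp add: powr_diff)
  qed measurable
  have "emeasure W {\<omega> \<in> space W. (\<integral>x. g x \<partial>P \<omega>) \<le> \<sigma>} = emeasure Z {..0}"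
  proof -
    let ?T = "{m \<in> space bfm_algebra. (\<integral>x. g x \<partial>normalized m) \<le> \<sigma>}"
    have "{\<omega> \<in> space W. (\<integral>x. g x \<partial>P \<omega>) \<le> \<sigma>} = \<mu>\<^sub>\<gamma>\<^sub>\<theta> -` ?T \<inter> space W"
      using measurable_space[OF assms(11)] by (auto simp: assms(13))
    also have "emeasure W \<dots> = emeasure (distr W bfm_algebra \<mu>\<^sub>\<gamma>\<^sub>\<theta>) ?T"
      by (rule emeasure_distr[symmetric, OF assms(11)]) (rule sets_mean_le[OF assms(14)])
    also have "\<dots> = emeasure Z {..0}"
      unfolding assms(12) T.emeasure_tilted_law_mean_le[OF assms(14) h'] Z_def
      by (subst T.emeasure_Z_law[OF _ h]) (simp_all add: h_def[abs_def])
    finally show ?thesis .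
  qed
  then have "measure W {\<omega> \<in> space W. (\<integral>x. g x \<partial>P \<omega>) \<le> \<sigma>} = measure Z {..0}"
    by (simp add: measure_def)
  then show ?thesis
    using Z.Gil_Pelaez_0[OF lim int] int by (simp add: integrand)
qed

end
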